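(* Let $M$ be a regular, loopless matroid of rank $n$ on a finite set $E$ and let $R\subseteq E$. Suppose that $\widetilde{N}_0>0$ and $\widetilde{N}_n>0$. Then $\widetilde{N}_1^n=\widetilde{N}_0^{n-1}\widetilde{N}_n$ if and only if $\widetilde{N}_k^2=\widetilde{N}_{k-1}\widetilde{N}_{k+1}$ for some $k\in\{1,\dots,n-1\}$.
   Context: For $0\le k\le n$, $N_k$ is the number of bases of $M$ with exactly $k$ elements in $R$, and $\widetilde{N}_k=N_k/\binom{n}{k}$. A matroid is regular if it is representable over $\mathbb{R}$ by a totally unimodular matrix (equivalently, representable over every field).
   Formalization: The rank n is assumed to be at least 2; for n = 0 and n = 1 the range {1,…,n−1} is empty while the first equality always holds, so the stated equivalence fails there (e.g. U_{1,2} with R a single element). *)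

theory Defs
  imports
    Complex_Main
    "Jordan_Normal_Form.VS_Connect"
    "Jordan_Normal_Form.DL_Submatrix"
begin

section \<open>Matroids\<close>

locale matroid =
  fixes E :: "'a set" and indep :: "'a set \<Rightarrow> bool"
  assumes finite_ground: "finite E"
    and indep_subset_ground: "indep I \<Longrightarrow> I \<subseteq> E"
    and indep_empty: "indep {}"
    and indep_mono: "indep I \<Longrightarrow> J \<subseteq> I \<Longrightarrow> indep J"
    and indep_augment:
      "indep I \<Longrightarrow> indep J \<Longrightarrow> card I < card J \<Longrightarrow> \<exists>e\<in>J - I. indep (insert e I)"

definition matroid_basis :: "('a set \<Rightarrow> bool) \<Rightarrow> 'a set \<Rightarrow> bool" where
  "matroid_basis indep B \<longleftrightarrow> indep B \<and> (\<forall>I. indep I \<and> B \<subseteq> I \<longrightarrow> I = B)"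

definition matroid_rank :: "('a set \<Rightarrow> bool) \<Rightarrow> nat" where
  "matroid_rank indep = Max (card ` {I. indep I})"

definition loopless :: "'a set \<Rightarrow> ('a set \<Rightarrow> bool) \<Rightarrow> bool" where
  "loopless E indep \<longleftrightarrow> (\<forall>e\<in>E. indep {e})"


section \<open>Regular matroids\<close>

definition totally_unimodular :: "real mat \<Rightarrow> bool" where
  "totally_unimodular A \<longleftrightarrow>
     (\<forall>I J. I \<subseteq> {..<dim_row A} \<and> J \<subseteq> {..<dim_col A} \<and> card I = card J
        \<longrightarrow> det (submatrix A I J) \<in> {-1, 0, 1})"

text \<open>
  The columns of \<open>A\<close> are labelled by the ground set through the bijection \<open>\<phi>\<close>.
  The linear independence meant here is that of the indexed family of columns, so parallel
  elements, whose columns may coincide as vectors, are dependent; as \<open>lin_dep\<close>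
  speaks about sets of vectors, injectivity is required in addition.
\<close>
definition represented_by ::
  "'a set \<Rightarrow> ('a set \<Rightarrow> bool) \<Rightarrow> real mat \<Rightarrow> ('a \<Rightarrow> nat) \<Rightarrow> bool" where
  "represented_by E indep A \<phi> \<longleftrightarrow>
     bij_betw \<phi> E {..<dim_col A} \<and>
     (\<forall>S\<subseteq>E. indep S \<longleftrightarrow>
        inj_on (\<lambda>e. col A (\<phi> e)) S \<and>
        \<not> LinearCombinations.module.lin_dep class_ring (module_vec TYPE(real) (dim_row A))
            ((\<lambda>e. col A (\<phi> e)) ` S))"

definition regular_matroid :: "'a set \<Rightarrow> ('a set \<Rightarrow> bool) \<Rightarrow> bool" where
  "regular_matroid E indep \<longleftrightarrow>
     matroid E indep \<and> (\<exists>A \<phi>. totally_unimodular A \<and> represented_by E indep A \<phi>)"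


section \<open>Counting bases by their intersection with a set\<close>

definition basis_count :: "('a set \<Rightarrow> bool) \<Rightarrow> 'a set \<Rightarrow> nat \<Rightarrow> nat" where
  "basis_count indep R k = card {B. matroid_basis indep B \<and> card (B \<inter> R) = k}"

definition norm_basis_count :: "('a set \<Rightarrow> bool) \<Rightarrow> 'a set \<Rightarrow> nat \<Rightarrow> real" where
  "norm_basis_count indep R k =
     real (basis_count indep R k) / real (matroid_rank indep choose k)"

end

theory Submission
  imports Defs "Jordan_Normal_Form.Char_Poly"
begin

text \<open>
  After passing to \<open>n\<close> suitable rows of a totally unimodular representation with columns \<open>a\<^sub>e\<close>,
  the Cauchy--Binet formula gives \<open>\<Sum>\<^sub>k N\<^sub>k t\<^sup>k = det (P + t Q)\<close>, where \<open>P\<close> and \<open>Q\<close> are the sums of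
  \<open>a\<^sub>e a\<^sub>e\<^sup>T\<close> over \<open>e \<notin> R\<close> and \<open>e \<in> R\<close>. If \<open>(P + z Q) v = 0\<close> with \<open>v \<noteq> 0\<close>, then
  \<open>v\<^sup>* P v + z v\<^sup>* Q v = 0\<close> shows that \<open>z\<close> is real and nonpositive, and \<open>N\<^sub>0 \<noteq> 0\<close> excludes \<open>z = 0\<close>.
  Hence \<open>N\<^sub>k\<close> is \<open>N\<^sub>0\<close> times the \<open>k\<close>-th elementary symmetric function of \<open>n\<close> positive reals, and both
  conditions of the theorem say that these reals coincide: one is the equality case of Newton's
  inequality, the other that of Maclaurin's.
\<close>

section \<open>Equality in the inequalities of Newton and Maclaurin\<close>

text \<open>Encoded as a coefficient of a product of linear factors, so that prepending a list entry
  is one polynomial multiplication and a factored polynomial can be compared directly.\<close>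

definition esym :: "real list \<Rightarrow> nat \<Rightarrow> real" where
  "esym xs k = coeff (\<Prod>x\<leftarrow>xs. [:1, x:]) k"

definition esym_mean :: "real list \<Rightarrow> nat \<Rightarrow> real" where
  "esym_mean xs k = esym xs k / real (length xs choose k)"

lemma esym_Nil: "esym [] k = (if k = 0 then 1 else 0)"
  by (simp add: esym_def)

lemma esym_0 [simp]: "esym xs 0 = 1"
  by (induction xs) (simp_all add: esym_def)

lemma esym_Cons_Suc: "esym (x # xs) (Suc k) = esym xs (Suc k) + x * esym xs k"
  by (simp add: esym_def)

lemma esym_eq_0: "length xs < k \<Longrightarrow> esym xs k = 0"
proof (induction xs arbitrary: k)
  case (Cons x xs)
  then show ?case by (cases k) (simp_all add: esym_Cons_Suc)
qed (simp add: esym_Nil)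

lemma esym_pos:
  assumes "\<forall>x\<in>set xs. x > 0" "k \<le> length xs"
  shows "esym xs k > 0"
  using assms
proof (induction xs arbitrary: k)
  case (Cons x xs)
  show ?case
  proof (cases k)
    case (Suc j)
    then have "esym xs j > 0" using Cons by auto
    \<comment> \<open>Only nonnegativity is available: this term vanishes when \<open>Suc j\<close>
      exceeds the length of \<open>xs\<close>.\<close>
    moreover have "esym xs (Suc j) \<ge> 0"
      using Cons Suc esym_eq_0[of xs "Suc j"] by (cases "Suc j \<le> length xs") (auto intro: less_imp_le)
    ultimately show ?thesis using Cons.prems(1) Suc
      by (simp add: esym_Cons_Suc add_nonneg_pos)
  qed simp
qed (simp add: esym_Nil)

lemma esym_replicate: "esym (replicate n \<mu>) k = real (n choose k) * \<mu> ^ k"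
proof (induction n arbitrary: k)
  case (Suc n)
  then show ?case by (cases k) (simp_all add: esym_Cons_Suc algebra_simps)
qed (simp add: esym_Nil)

lemma esym_mean_0 [simp]: "esym_mean xs 0 = 1"
  by (simp add: esym_mean_def)

lemma esym_mean_pos: "\<forall>x\<in>set xs. x > 0 \<Longrightarrow> k \<le> length xs \<Longrightarrow> esym_mean xs k > 0"
  by (simp add: esym_mean_def esym_pos)

lemma esym_mean_constant:
  assumes "\<forall>x\<in>set xs. x = \<mu>" "k \<le> length xs"
  shows "esym_mean xs k = \<mu> ^ k"
proof -
  have "xs = replicate (length xs) \<mu>" using assms(1) by (simp add: replicate_eqI)
  then show ?thesis
    using esym_replicate[of "length xs" \<mu> k] assms(2) by (simp add: esym_mean_def)
qed

section \<open>Recursion for the means and Newton's inequality\<close>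

lemma mult_divide_exchange:
  fixes C D p q z :: real
  assumes "D * p = q * C" "C > 0" "D > 0"
  shows "q * (z / D) = p * z / C"
proof -
  have q: "q = D * p / C" using assms by (simp add: field_simps)
  show ?thesis unfolding q using assms(2,3) by simp
qed

text \<open>The recursion for \<open>esym\<close> divided by the binomials: the absorption
  identities turn both denominators into \<open>n choose k\<close> and leave the weights
  \<open>n - k\<close> and \<open>k + 1\<close>.\<close>

lemma esym_mean_Cons_Suc:
  assumes "k \<le> length xs"
  shows "(real (length xs) + 1) * esym_mean (x # xs) (Suc k)
    = (real (length xs) - real k) * esym_mean xs (Suc k) + (real k + 1) * x * esym_mean xs k"
proof -
  define n where "n = length xs"
  have kn: "k \<le> n" using assms by (simp add: n_def)
  have c0: "real (n choose k) > 0" using kn by simp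
  have "(Suc n choose Suc k) * Suc k = Suc n * (n choose k)"
    using Suc_times_binomial_eq[of n k] by (simp only: mult.commute)
  then have "real ((Suc n choose Suc k) * Suc k) = real (Suc n * (n choose k))"
    by (rule arg_cong)
  then have c1: "real (Suc n choose Suc k) * (real k + 1) = (real n + 1) * real (n choose k)"
    by (simp only: of_nat_mult of_nat_Suc add.commute)
  have 1: "(real n + 1) * esym_mean (x # xs) (Suc k)
     = (real k + 1) * (esym xs (Suc k) + x * esym xs k) / real (n choose k)"
    unfolding esym_mean_def esym_Cons_Suc length_Cons n_def[symmetric]
    by (rule mult_divide_exchange[OF c1 c0]) (use kn in \<open>simp add: add_pos_nonneg\<close>)
  have 2: "(real n - real k) * esym_mean xs (Suc k) = (real k + 1) * esym xs (Suc k) / real (n choose k)"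
  \<comment> \<open>For \<open>k = n\<close> the binomial \<open>n choose Suc k\<close> is zero, so
    the denominators cannot be exchanged; both sides vanish instead.\<close>
  proof (cases "k = n")
    case True
    then show ?thesis using esym_eq_0[of xs "Suc k"] by (simp add: n_def)
  next
    case False
    have "real (n choose Suc k) * (real k + 1) = (real n - real k) * real (n choose k)"
      using c1 by (simp add: algebra_simps)
    then show ?thesis
      unfolding esym_mean_def n_def[symmetric]
      by (rule mult_divide_exchange[OF _ c0]) (use False kn in simp_all)
  qed
  have 3: "(real k + 1) * (x * esym xs k) / real (n choose k) = (real k + 1) * x * esym_mean xs k"
    by (simp add: esym_mean_def n_def)
  have "(real n + 1) * esym_mean (x # xs) (Suc k)
     = (real k + 1) * esym xs (Suc k) / real (n choose k)
       + (real k + 1) * (x * esym xs k) / real (n choose k)"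
    unfolding 1 by (simp only: distrib_left add_divide_distrib)
  then show ?thesis unfolding n_def[symmetric] 2 3 .
qed

text \<open>Induction on the list. The Newton difference of \<open>x # xs\<close> is a combination
  of a square, two Newton differences of \<open>xs\<close> and a cross term. Inequality and equality
  case go through one induction, because equality for \<open>x # xs\<close> forces equality for
  \<open>xs\<close> at a neighbouring index.\<close>

lemma newton_inequality:
  assumes "\<forall>x\<in>set xs. x > 0" "Suc k < length xs"
  shows "esym_mean xs k * esym_mean xs (Suc (Suc k)) \<le> (esym_mean xs (Suc k))\<^sup>2 \<and>
    (esym_mean xs k * esym_mean xs (Suc (Suc k)) = (esym_mean xs (Suc k))\<^sup>2
      \<longrightarrow> (\<exists>\<mu>. \<forall>x\<in>set xs. x = \<mu>))"
  using assms
proof (induction xs arbitrary: k)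
  case (Cons x xs)
  define n where "n = length xs"
  have pos: "\<forall>y\<in>set xs. y > 0" and x: "x > 0" and kn: "Suc k \<le> n"
    using Cons.prems by (auto simp: n_def)
  text \<open>
    The factor \<open>real k\<close> removes the missing mean of index \<open>-1\<close> when \<open>k = 0\<close>, and \<open>q = 0\<close> removes \<open>e\<close>
    when it lies beyond the length of \<open>xs\<close>; \<open>key\<close> is then a sum of nonnegative terms.
  \<close>
  define a where "a = (if k = 0 then 0 else esym_mean xs (k - 1))"
  define b where "b = esym_mean xs k"
  define d where "d = esym_mean xs (Suc k)"
  define e where "e = esym_mean xs (Suc (Suc k))"
  define q where "q = real n - real k - 1"
  have q: "q \<ge> 0" using kn by (simp add: q_def)
  have bp: "b > 0" and dp: "d > 0"
    using esym_mean_pos[OF pos] kn by (auto simp: b_def d_def n_def)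
  \<comment> \<open>The recursion at the indices \<open>k\<close>, \<open>k + 1\<close>,
    \<open>k + 2\<close>; in terms of \<open>q\<close> its first weights are \<open>q + 2\<close>,
    \<open>q + 1\<close> and \<open>q\<close>.\<close>
  have r0: "(real n + 1) * esym_mean (x # xs) k = (q + 2) * b + real k * x * a"
  proof (cases k)
    case (Suc j)
    then show ?thesis using esym_mean_Cons_Suc[of j xs x] kn
      by (simp add: a_def b_def q_def n_def algebra_simps)
  qed (simp add: b_def q_def)
  have r1: "(real n + 1) * esym_mean (x # xs) (Suc k) = (q + 1) * d + (real k + 1) * x * b"
    using esym_mean_Cons_Suc[of k xs x] kn by (simp add: b_def d_def q_def n_def)
  have r2: "(real n + 1) * esym_mean (x # xs) (Suc (Suc k)) = q * e + (real k + 2) * x * d"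
    using esym_mean_Cons_Suc[of "Suc k" xs x] kn by (simp add: e_def d_def q_def n_def algebra_simps)
  have ihq: "b * e \<le> d\<^sup>2" "b * e = d\<^sup>2 \<Longrightarrow> \<exists>\<mu>. \<forall>y\<in>set xs. y = \<mu>" if "q > 0"
    using Cons.IH[OF pos, of k] that by (auto simp: b_def d_def e_def q_def n_def)
  have ihk: "a * d \<le> b\<^sup>2" "a * d = b\<^sup>2 \<Longrightarrow> \<exists>\<mu>. \<forall>y\<in>set xs. y = \<mu>" if "k > 0"
    using Cons.IH[OF pos, of "k - 1"] that kn by (auto simp: a_def b_def d_def n_def)
  have ap: "a > 0" if "k > 0"
    using esym_mean_pos[OF pos, of "k - 1"] that kn by (auto simp: a_def n_def)
  have ep: "e > 0" if "q > 0"
    using esym_mean_pos[OF pos, of "Suc (Suc k)"] that by (auto simp: e_def q_def n_def)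
  have t1: "q * (q + 2) * (d\<^sup>2 - b * e) \<ge> 0"
    using ihq(1) q by (cases "q = 0") auto
  have t2: "real k * (real k + 2) * x\<^sup>2 * (b\<^sup>2 - a * d) \<ge> 0"
    using ihk(1) by (cases "k = 0") auto
  \<comment> \<open>The product of the two Newton inequalities for \<open>xs\<close> reads
    \<open>b * d * a * e \<le> b\<^sup>2 * d\<^sup>2\<close>; cancelling \<open>b * d\<close>
    compares \<open>a * e\<close> with \<open>b * d\<close>.\<close>
  have t3: "x * real k * q * (b * d - a * e) \<ge> 0"
  proof (cases "k > 0 \<and> q > 0")
    case True
    have "(b * d) * (a * e) = (a * d) * (b * e)" by simp
    also have "\<dots> \<le> b\<^sup>2 * d\<^sup>2"
      using ihk(1) ihq(1) True ep bp by (intro mult_mono) auto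
    also have "\<dots> = (b * d) * (b * d)" by (simp add: power2_eq_square)
    finally have "a * e \<le> b * d" using bp dp by simp
    then show ?thesis using x q by simp
  qed (use q in auto)
  \<comment> \<open>Write \<open>(q + 1)\<^sup>2 = q * (q + 2) + 1\<close> and
    \<open>(k + 1)\<^sup>2 = k * (k + 2) + 1\<close>: the two leftover units, together with
    \<open>- 2 * x * b * d\<close> from the mixed terms, form the square of
    \<open>d - x * b\<close>.\<close>
  have key: "(real n + 1)\<^sup>2 * ((esym_mean (x # xs) (Suc k))\<^sup>2
        - esym_mean (x # xs) k * esym_mean (x # xs) (Suc (Suc k)))
      = (d - x * b)\<^sup>2 + q * (q + 2) * (d\<^sup>2 - b * e)
        + real k * (real k + 2) * x\<^sup>2 * (b\<^sup>2 - a * d) + x * real k * q * (b * d - a * e)"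
    (is "?L = _")
  proof -
    have "?L = ((real n + 1) * esym_mean (x # xs) (Suc k))\<^sup>2
        - ((real n + 1) * esym_mean (x # xs) k) * ((real n + 1) * esym_mean (x # xs) (Suc (Suc k)))"
      by (simp add: algebra_simps power2_eq_square)
    then show ?thesis unfolding r0 r1 r2 by (simp add: algebra_simps power2_eq_square)
  qed
  then have "?L \<ge> 0" using t1 t2 t3 by simp
  then have ge: "esym_mean (x # xs) k * esym_mean (x # xs) (Suc (Suc k)) \<le> (esym_mean (x # xs) (Suc k))\<^sup>2"
    by (simp add: zero_le_mult_iff)
  have "\<exists>\<mu>. \<forall>y\<in>set (x # xs). y = \<mu>"
    if eq: "esym_mean (x # xs) k * esym_mean (x # xs) (Suc (Suc k)) = (esym_mean (x # xs) (Suc k))\<^sup>2"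
  proof -
    have "(d - x * b)\<^sup>2 + q * (q + 2) * (d\<^sup>2 - b * e)
        + real k * (real k + 2) * x\<^sup>2 * (b\<^sup>2 - a * d) + x * real k * q * (b * d - a * e) = 0"
      using key eq by simp
    moreover have "(d - x * b)\<^sup>2 \<ge> 0" by simp
    ultimately have e1: "(d - x * b)\<^sup>2 = 0" and e2: "q * (q + 2) * (d\<^sup>2 - b * e) = 0"
      and e3: "real k * (real k + 2) * x\<^sup>2 * (b\<^sup>2 - a * d) = 0"
      using t1 t2 t3 by linarith+
    have "\<exists>\<mu>. \<forall>y\<in>set xs. y = \<mu>"
    proof -
      \<comment> \<open>At least one Newton difference of \<open>xs\<close> occurs with a positive
        factor, unless \<open>q = k = 0\<close>; then \<open>xs\<close> has a single entry.\<close>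
      consider "q > 0" | "k > 0" | "q = 0" "k = 0" using q by force
      then show ?thesis
      proof cases
        case 1
        then show ?thesis using ihq(2) e2 by auto
      next
        case 2
        then show ?thesis using ihk(2) e3 x by auto
      next
        case 3
        then have "length xs = Suc 0" by (simp add: q_def n_def)
        then obtain y where "xs = [y]" by (cases xs) auto
        then show ?thesis by auto
      qed
    qed
    then obtain \<mu> where \<mu>: "\<forall>y\<in>set xs. y = \<mu>" by blast
    \<comment> \<open>For constant \<open>xs\<close> the means are powers of \<open>\<mu>\<close>,
      so the vanishing square determines \<open>x\<close>.\<close>
    have "d = \<mu> * b"
      using esym_mean_constant[OF \<mu>] kn by (simp add: b_def d_def n_def)
    then have "x = \<mu>" using e1 bp by simp
    then show ?thesis using \<mu> by auto
  qed
  then show ?case using ge by blast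
qed simp

section \<open>Maclaurin's inequality and the equality criterion\<close>

lemma maclaurin_step:
  assumes pos: "\<forall>x\<in>set xs. x > 0" and "k < length xs"
  shows "esym_mean xs (Suc k) \<le> esym_mean xs 1 * esym_mean xs k"
  using assms(2)
proof (induction k)
  case (Suc k)
  have p: "esym_mean xs k > 0" "esym_mean xs (Suc k) > 0"
    using esym_mean_pos[OF pos] Suc.prems by auto
  \<comment> \<open>Newton's inequality says that ratios of consecutive means do not increase, so
    each is at most the first one, \<open>esym_mean xs 1\<close>.\<close>
  have "esym_mean xs k * esym_mean xs (Suc (Suc k)) \<le> (esym_mean xs (Suc k))\<^sup>2"
    using newton_inequality[OF pos] Suc.prems by blast
  also have "\<dots> = esym_mean xs (Suc k) * esym_mean xs (Suc k)" by (simp add: power2_eq_square)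
  also have "\<dots> \<le> esym_mean xs (Suc k) * (esym_mean xs 1 * esym_mean xs k)"
    using Suc p by (intro mult_left_mono) auto
  finally have "esym_mean xs k * esym_mean xs (Suc (Suc k))
      \<le> esym_mean xs k * (esym_mean xs 1 * esym_mean xs (Suc k))"
    by (simp add: ac_simps)
  then show ?case using p by simp
qed simp

text \<open>Equality at some \<open>k\<close> makes the list constant by Newton, and then all means
  are powers of one number. Conversely, equality at \<open>n\<close> already yields the condition
  for \<open>k = 1\<close>.\<close>

lemma esym_mean_equality_iff:
  assumes pos: "\<forall>x\<in>set xs. x > 0" and n: "length xs = n" "n \<ge> 2"
  shows "esym_mean xs 1 ^ n = esym_mean xs n \<longleftrightarrow>
    (\<exists>k\<in>{1..n - 1}. (esym_mean xs k)\<^sup>2 = esym_mean xs (k - 1) * esym_mean xs (k + 1))"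
    (is "?L \<longleftrightarrow> ?R")
proof
  assume ?R
  then obtain k where "k \<in> {1..n - 1}"
    "(esym_mean xs k)\<^sup>2 = esym_mean xs (k - 1) * esym_mean xs (k + 1)" by blast
  then have "\<exists>\<mu>. \<forall>x\<in>set xs. x = \<mu>"
    using newton_inequality[OF pos, of "k - 1"] n by auto
  then obtain \<mu> where "\<forall>x\<in>set xs. x = \<mu>" by blast
  then show ?L using esym_mean_constant[of xs \<mu>] n by simp
next
  assume L: ?L
  have p1: "esym_mean xs 1 > 0" using esym_mean_pos[OF pos] n by simp
  \<comment> \<open>A strict inequality at index 2 would be carried up to index \<open>n\<close> by
    \<open>maclaurin_step\<close>.\<close>
  have "(esym_mean xs 1)\<^sup>2 \<le> esym_mean xs 2"
  proof (rule ccontr)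
    assume "\<not> ?thesis"
    then have lt: "esym_mean xs 2 < esym_mean xs 1 ^ 2" by simp
    have "esym_mean xs k < esym_mean xs 1 ^ k" if "2 \<le> k" "k \<le> n" for k
      using that
    proof (induction k rule: dec_induct)
      case (step k)
      have "esym_mean xs (Suc k) \<le> esym_mean xs 1 * esym_mean xs k"
        using maclaurin_step[OF pos] step n by simp
      also have "\<dots> < esym_mean xs 1 * esym_mean xs 1 ^ k"
        using step p1 by (intro mult_strict_left_mono) auto
      finally show ?case by simp
    qed (use lt in simp)
    from this[of n] show False using L n by simp
  qed
  moreover have "esym_mean xs 2 \<le> (esym_mean xs 1)\<^sup>2"
    using maclaurin_step[OF pos, of 1] n by (simp add: power2_eq_square numeral_2_eq_2)
  ultimately have "(esym_mean xs 1)\<^sup>2 = esym_mean xs (1 - 1) * esym_mean xs (1 + 1)"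
    by (simp add: numeral_2_eq_2)
  then show ?R using n by (intro bexI[of _ 1]) auto
qed

section \<open>Polynomials with negative real roots\<close>

lemma map_poly_of_real_mult:
  "map_poly complex_of_real (p * q) = map_poly complex_of_real p * map_poly complex_of_real q"
  by (rule poly_eqI) (simp add: coeff_mult coeff_map_poly)

text \<open>A root \<open>- t\<close> contributes \<open>X + t = t * (1 + X / t)\<close>, so the
  list consists of the reciprocals \<open>1 / t\<close> and the scalars collect in the constant
  coefficient.\<close>

lemma esym_of_negative_roots:
  fixes p :: "real poly"
  assumes roots: "\<And>z. poly (map_poly complex_of_real p) z = 0 \<Longrightarrow> \<exists>t>0. z = - complex_of_real t"
  obtains xs where "length xs = degree p" "\<forall>x\<in>set xs. x > 0"
    "\<And>k. coeff p k = coeff p 0 * esym xs k"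
proof -
  define P where "P = map_poly complex_of_real p"
  obtain as where as: "smult (coeff P (degree P)) (\<Prod>a\<leftarrow>as. [:- a, 1:]) = P" "length as = degree P"
    using fundamental_theorem_algebra_factorized[of P] by blast
  have neg: "\<exists>t>0. a = - complex_of_real t" if "a \<in> set as" for a
  proof -
    have "poly (\<Prod>a\<leftarrow>as. [:- a, 1:]) a = 0"
      using that by (induction as) auto
    then have "poly P a = 0" by (subst as(1)[symmetric]) simp
    then show ?thesis using roots by (simp add: P_def)
  qed
  define xs where "xs = map (\<lambda>a. - 1 / Re a) as"
  \<comment> \<open>Stated for lists \<open>bs\<close> of roots so that the induction keeps the
    negativity of every entry; \<open>C\<close> is the product of the numbers
    \<open>- a\<close>.\<close>
  have fac: "\<exists>C. (\<Prod>a\<leftarrow>bs. [:- a, 1:]) = smult C (map_poly complex_of_real (\<Prod>x\<leftarrow>map (\<lambda>a. - 1 / Re a) bs. [:1, x:]))"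
    if "set bs \<subseteq> set as" for bs
    using that
  proof (induction bs)
    case (Cons a bs)
    have bs: "set bs \<subseteq> set as" and a: "a \<in> set as" using Cons.prems by auto
    from Cons.IH[OF bs] obtain C where C: "(\<Prod>a\<leftarrow>bs. [:- a, 1:])
      = smult C (map_poly complex_of_real (\<Prod>x\<leftarrow>map (\<lambda>a. - 1 / Re a) bs. [:1, x:]))" by blast
    from neg[OF a] obtain t where t: "t > 0" "a = - complex_of_real t" by blast
    have "[:- a, 1:] = smult (- a) (map_poly complex_of_real [:1, - 1 / Re a:])"
      using t by (simp add: map_poly_pCons)
    then have "(\<Prod>a\<leftarrow>a # bs. [:- a, 1:])
      = smult (C * - a) (map_poly complex_of_real [:1, - 1 / Re a:]
          * map_poly complex_of_real (\<Prod>x\<leftarrow>map (\<lambda>a. - 1 / Re a) bs. [:1, x:]))"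
      by (simp only: list.map prod_list.Cons C mult_smult_left mult_smult_right smult_smult)
    also have "map_poly complex_of_real [:1, - 1 / Re a:]
          * map_poly complex_of_real (\<Prod>x\<leftarrow>map (\<lambda>a. - 1 / Re a) bs. [:1, x:])
        = map_poly complex_of_real (\<Prod>x\<leftarrow>map (\<lambda>a. - 1 / Re a) (a # bs). [:1, x:])"
      by (simp only: list.map prod_list.Cons map_poly_of_real_mult)
    finally show ?case by (rule exI)
  next
    case Nil
    show ?case by (rule exI[of _ 1]) simp
  qed
  obtain C where C: "(\<Prod>a\<leftarrow>as. [:- a, 1:]) = smult C (map_poly complex_of_real (\<Prod>x\<leftarrow>xs. [:1, x:]))"
    using fac[OF subset_refl] unfolding xs_def by blast
  define D where "D = coeff P (degree P) * C"
  have D: "smult D (map_poly complex_of_real (\<Prod>x\<leftarrow>xs. [:1, x:])) = P"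
    using as(1) unfolding C D_def by (simp only: smult_smult)
  have co: "coeff P k = D * complex_of_real (esym xs k)" for k
    unfolding D[symmetric] by (simp add: coeff_map_poly esym_def)
  \<comment> \<open>The case \<open>k = 0\<close>, where \<open>esym\<close> is 1, identifies
    \<open>D\<close> with the constant coefficient.\<close>
  have cc: "complex_of_real (coeff p k) = complex_of_real (coeff p 0 * esym xs k)" for k
    unfolding of_real_mult using co[of k] co[of 0] unfolding P_def by (simp add: coeff_map_poly)
  have "coeff p k = coeff p 0 * esym xs k" for k
    using cc[of k] by (simp only: of_real_eq_iff)
  moreover have "\<forall>x\<in>set xs. x > 0"
  proof
    fix x assume "x \<in> set xs"
    then obtain a where a: "a \<in> set as" "x = - 1 / Re a" by (auto simp: xs_def)
    then obtain t where "t > 0" "a = - complex_of_real t" using neg by blast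
    then show "x > 0" using a(2) by simp
  qed
  moreover have "length xs = degree p" using as(2) by (simp add: xs_def P_def)
  ultimately show ?thesis using that by blast
qed

section \<open>Determinants of weighted Gram matrices\<close>

text \<open>Minors are indexed by tuples of column labels instead of sets: the label type needs no
  order, and reordering columns is composition with a permutation.\<close>

definition tuple_det :: "nat \<Rightarrow> (nat \<Rightarrow> 'e \<Rightarrow> 'a::comm_ring_1) \<Rightarrow> (nat \<Rightarrow> 'e) \<Rightarrow> 'a" where
  "tuple_det n a f = det (mat n n (\<lambda>(i, j). a i (f j)))"

lemma tuple_det_expand:
  "tuple_det n a f = (\<Sum>p | p permutes {0..<n}. signof p * (\<Prod>i = 0..<n. a (p i) (f i)))"
  unfolding tuple_det_def
  by (subst mat_det_left_def[where n = n])
     (auto intro!: sum.cong prod.cong arg_cong2[where f = "(*)"] simp: permutes_nat_less)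

lemma tuple_det_permute_rows:
  assumes "p permutes {0..<n}"
  shows "tuple_det n (\<lambda>i. a (p i)) f = signof p * tuple_det n a f"
proof -
  have "mat n n (\<lambda>(i, j). a (p i) (f j)) = mat n n (\<lambda>(i, j). mat n n (\<lambda>(i, j). a i (f j)) $$ (p i, j))"
    using permutes_nat_less[OF assms] by (intro eq_matI) auto
  then show ?thesis
    unfolding tuple_det_def using det_permute_rows[OF _ assms, of "mat n n (\<lambda>(i, j). a i (f j))"]
    by simp
qed

lemma tuple_det_transpose: "tuple_det n (\<lambda>i j. a j i) id = tuple_det n a id"
proof -
  have "mat n n (\<lambda>(i, j). a j i) = transpose_mat (mat n n (\<lambda>(i, j). a i j))"
    by (intro eq_matI) auto
  then show ?thesis
    unfolding tuple_det_def using det_transpose[of "mat n n (\<lambda>(i, j). a i j)" n] by simp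
qed

lemma tuple_det_permute_cols:
  assumes "p permutes {0..<n}"
  shows "tuple_det n a (f \<circ> p) = signof p * tuple_det n a f"
proof -
  have "tuple_det n a (f \<circ> p) = tuple_det n (\<lambda>i j. a i (f (p j))) id" by (simp add: tuple_det_def)
  also have "\<dots> = tuple_det n (\<lambda>i. (\<lambda>i j. a j (f i)) (p i)) id" by (subst tuple_det_transpose[symmetric]) simp
  also have "\<dots> = signof p * tuple_det n (\<lambda>i j. a j (f i)) id" by (rule tuple_det_permute_rows[OF assms])
  also have "\<dots> = signof p * tuple_det n a f"
    by (subst tuple_det_transpose) (simp add: tuple_det_def)
  finally show ?thesis .
qed

lemma tuple_det_not_inj:
  assumes "\<not> inj_on f {0..<n}"
  shows "tuple_det n a f = 0"
proof -
  obtain i j where "i < n" "j < n" "i \<noteq> j" "f i = f j" using assms by (auto simp: inj_on_def)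
  then show ?thesis
    unfolding tuple_det_def
    by (intro det_identical_columns[where n = n and i = i and j = j] eq_vecI) auto
qed

lemma tuple_det_of_real:
  "tuple_det n (\<lambda>i e. complex_of_real (a i e)) f = complex_of_real (tuple_det n a f)"
proof -
  have "mat n n (\<lambda>(i, j). complex_of_real (a i (f j))) = map_mat complex_of_real (mat n n (\<lambda>(i, j). a i (f j)))"
    by (intro eq_matI) auto
  then show ?thesis by (simp add: tuple_det_def)
qed

section \<open>The Cauchy-Binet expansion of weighted Gram determinants\<close>

definition gram :: "nat \<Rightarrow> (nat \<Rightarrow> 'e \<Rightarrow> 'a::comm_ring_1) \<Rightarrow> 'e set \<Rightarrow> ('e \<Rightarrow> 'a) \<Rightarrow> 'a mat" where
  "gram n a S w = mat n n (\<lambda>(i, k). \<Sum>e\<in>S. w e * a i e * a k e)"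

text \<open>Distributing the Leibniz products over the sums in the entries chooses one label
  \<open>f i\<close> per row; the remaining sum over permutations is the expansion of
  \<open>tuple_det n a f\<close>.\<close>

lemma det_gram_eq:
  assumes "finite S"
  shows "det (gram n a S w) =
    (\<Sum>f\<in>{0..<n} \<rightarrow>\<^sub>E S. (\<Prod>i = 0..<n. w (f i)) * (\<Prod>i = 0..<n. a i (f i)) * tuple_det n a f)"
proof -
  have "det (gram n a S w) =
      (\<Sum>p | p permutes {0..<n}. signof p * (\<Prod>i = 0..<n. \<Sum>e\<in>S. w e * a i e * a (p i) e))"
    by (subst det_def'[where n = n])
       (auto simp: gram_def permutes_nat_less intro!: sum.cong prod.cong arg_cong2[where f = "(*)"])
  also have "\<dots> = (\<Sum>p | p permutes {0..<n}. signof p *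
      (\<Sum>f\<in>{0..<n} \<rightarrow>\<^sub>E S. \<Prod>i = 0..<n. w (f i) * a i (f i) * a (p i) (f i)))"
    using assms by (subst prod_sum_PiE) auto
  also have "\<dots> = (\<Sum>f\<in>{0..<n} \<rightarrow>\<^sub>E S. \<Sum>p | p permutes {0..<n}. signof p *
      (\<Prod>i = 0..<n. w (f i) * a i (f i) * a (p i) (f i)))"
    by (subst sum.swap) (simp add: sum_distrib_left)
  also have "\<dots> = (\<Sum>f\<in>{0..<n} \<rightarrow>\<^sub>E S.
      (\<Prod>i = 0..<n. w (f i)) * (\<Prod>i = 0..<n. a i (f i)) * tuple_det n a f)"
    by (simp add: tuple_det_expand prod.distrib sum_distrib_left mult.assoc mult.left_commute)
  finally show ?thesis .
qed

lemma bij_betw_PiE_comp_permutes: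
  assumes p: "p permutes I"
  shows "bij_betw (\<lambda>f. f \<circ> p) (I \<rightarrow>\<^sub>E S) (I \<rightarrow>\<^sub>E S)"
proof (rule bij_betw_byWitness[where f' = "\<lambda>f. f \<circ> Hilbert_Choice.inv p"])
  have *: "f \<circ> q \<in> I \<rightarrow>\<^sub>E S" if "f \<in> I \<rightarrow>\<^sub>E S" "q permutes I" for f :: "'a \<Rightarrow> 'b" and q
    using that permutes_in_image[OF that(2)] by (auto simp: PiE_iff extensional_def)
  show "(\<lambda>f. f \<circ> p) ` (I \<rightarrow>\<^sub>E S) \<subseteq> I \<rightarrow>\<^sub>E S" using *[OF _ p] by blast
  show "(\<lambda>f. f \<circ> Hilbert_Choice.inv p) ` (I \<rightarrow>\<^sub>E S) \<subseteq> I \<rightarrow>\<^sub>E S" using *[OF _ permutes_inv[OF p]] by blast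
qed (use permutes_inv_o[OF p] in \<open>auto simp: comp_assoc\<close>)

text \<open>
  Averaging the expansion of the determinant over all reorderings of the tuple \<open>f\<close> produces the
  square, so that the sum need not be organised by subsets.
\<close>
lemma fact_det_gram:
  assumes "finite S"
  shows "fact n * det (gram n a S w) =
    (\<Sum>f\<in>{0..<n} \<rightarrow>\<^sub>E S. (\<Prod>i = 0..<n. w (f i)) * (tuple_det n a f)\<^sup>2)"
proof -
  \<comment> \<open>Replacing \<open>f\<close> by its composition with the inverse of
    \<open>p\<close> moves \<open>p\<close> to the row index and draws a sign from the determinant.
    Summing over \<open>p\<close> then completes the expansion of a second determinant.\<close>
  have "det (gram n a S w) = (\<Sum>f\<in>{0..<n} \<rightarrow>\<^sub>E S.
      (\<Prod>i = 0..<n. w (f i)) * tuple_det n a f * (signof p * (\<Prod>i = 0..<n. a (p i) (f i))))"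
    if p: "p permutes {0..<n}" for p
  proof -
    let ?q = "Hilbert_Choice.inv p"
    note q = permutes_inv[OF p]
    have rp: "(\<Prod>i = 0..<n. g (?q i)) = (\<Prod>i = 0..<n. g i)" for g :: "nat \<Rightarrow> 'b"
      using prod.permute[OF q, of g] by (simp add: comp_def)
    have "det (gram n a S w) = (\<Sum>f\<in>{0..<n} \<rightarrow>\<^sub>E S.
      (\<Prod>i = 0..<n. w ((f \<circ> ?q) i)) * (\<Prod>i = 0..<n. a i ((f \<circ> ?q) i)) * tuple_det n a (f \<circ> ?q))"
      unfolding det_gram_eq[OF assms]
      by (rule sum.reindex_bij_betw[OF bij_betw_PiE_comp_permutes[OF q], symmetric])
    also have "\<dots> = (\<Sum>f\<in>{0..<n} \<rightarrow>\<^sub>E S.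
      (\<Prod>i = 0..<n. w (f i)) * tuple_det n a f * (signof p * (\<Prod>i = 0..<n. a (p i) (f i))))"
    proof (rule sum.cong[OF refl])
      fix f
      have "(\<Prod>i = 0..<n. a i (f (?q i))) = (\<Prod>i = 0..<n. a (p i) (f i))"
        using rp[of "\<lambda>i. a (p i) (f i)"] permutes_inverses[OF p] by simp
      moreover have "(\<Prod>i = 0..<n. w (f (?q i))) = (\<Prod>i = 0..<n. w (f i))"
        by (rule rp)
      moreover have "signof (?q) = (signof p :: 'b)"
        by (metis finite_atLeastLessThan p permutation_permutes sign_inverse)
      ultimately show "(\<Prod>i = 0..<n. w ((f \<circ> ?q) i)) * (\<Prod>i = 0..<n. a i ((f \<circ> ?q) i)) * tuple_det n a (f \<circ> ?q)
        = (\<Prod>i = 0..<n. w (f i)) * tuple_det n a f * (signof p * (\<Prod>i = 0..<n. a (p i) (f i)))"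
        by (simp add: tuple_det_permute_cols[OF q] ac_simps)
    qed
    finally show ?thesis .
  qed
  then have "(\<Sum>p | p permutes {0..<n}. det (gram n a S w)) =
      (\<Sum>p | p permutes {0..<n}. \<Sum>f\<in>{0..<n} \<rightarrow>\<^sub>E S.
        (\<Prod>i = 0..<n. w (f i)) * tuple_det n a f * (signof p * (\<Prod>i = 0..<n. a (p i) (f i))))"
    by (intro sum.cong) auto
  also have "\<dots> = (\<Sum>f\<in>{0..<n} \<rightarrow>\<^sub>E S. (\<Prod>i = 0..<n. w (f i)) * (tuple_det n a f)\<^sup>2)"
    by (subst sum.swap) (simp add: sum_distrib_left[symmetric] tuple_det_expand[symmetric] power2_eq_square mult.assoc)
  finally show ?thesis
    using card_permutations[of "{0..<n}" n] by simp
qed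

text \<open>Composing with a fixed enumeration \<open>g\<close> of \<open>B\<close> matches
  permutations of the index set with injective tuples.\<close>

lemma card_inj_PiE:
  assumes "card B = n" "finite B"
  shows "card {f \<in> {0..<n} \<rightarrow>\<^sub>E B. inj_on f {0..<n}} = fact n"
proof -
  obtain g where g: "bij_betw g {0..<n} B" using ex_bij_betw_nat_finite[OF assms(2)] assms(1) by auto
  let ?F = "{f \<in> {0..<n} \<rightarrow>\<^sub>E B. inj_on f {0..<n}}"
  \<comment> \<open>Outside the index set a permutation is the identity, whereas an extensional
    tuple is \<open>undefined\<close> there; \<open>?h\<close> and \<open>restrict\<close> convert
    between the two.\<close>
  let ?h = "\<lambda>f i. if i < n then inv_into {0..<n} g (f i) else i"
  have "bij_betw (\<lambda>p. restrict (g \<circ> p) {0..<n}) {p. p permutes {0..<n}} ?F"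
  proof (rule bij_betw_byWitness[where f' = ?h])
    have g_inj: "inj_on g {0..<n}" and g_img: "\<And>i. i < n \<Longrightarrow> g i \<in> B"
      using g by (auto simp: bij_betw_def)
    show "\<forall>p\<in>{p. p permutes {0..<n}}. ?h (restrict (g \<circ> p) {0..<n}) = p"
    proof (intro ballI ext)
      fix p i assume p: "p \<in> {p. p permutes {0..<n}}"
      show "?h (restrict (g \<circ> p) {0..<n}) i = p i"
      proof (cases "i < n")
        case True
        then have "p i \<in> {0..<n}" using p permutes_in_image by fastforce
        then show ?thesis using True inv_into_f_f[OF g_inj] by simp
      next
        case False
        then show ?thesis using p permutes_not_in[of p "{0..<n}" i] by simp
      qed
    qed
    show "\<forall>f\<in>?F. restrict (g \<circ> ?h f) {0..<n} = f"
    proof (intro ballI ext)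
      fix f i assume f: "f \<in> ?F"
      show "restrict (g \<circ> ?h f) {0..<n} i = f i"
      proof (cases "i < n")
        case True
        then have "f i \<in> B" using f by (auto simp: PiE_iff)
        then show ?thesis using True bij_betw_inv_into_right[OF g] by simp
      next
        case False
        then show ?thesis using f PiE_arb[of f "{0..<n}" "\<lambda>_. B" i] by simp
      qed
    qed
    show "(\<lambda>p. restrict (g \<circ> p) {0..<n}) ` {p. p permutes {0..<n}} \<subseteq> ?F"
    proof clarify
      fix p assume p: "p permutes {0..<n}"
      have "inj_on (g \<circ> p) {0..<n}"
        using g_inj permutes_inj_on[OF p] permutes_image[OF p] by (intro comp_inj_on) auto
      then show "restrict (g \<circ> p) {0..<n} \<in> {0..<n} \<rightarrow>\<^sub>E B \<and> inj_on (restrict (g \<circ> p) {0..<n}) {0..<n}"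
        using permutes_in_image[OF p] g_img by auto
    qed
    show "?h ` ?F \<subseteq> {p. p permutes {0..<n}}"
    proof clarify
      fix f assume f: "f \<in> {0..<n} \<rightarrow>\<^sub>E B" "inj_on f {0..<n}"
      have gi: "bij_betw (inv_into {0..<n} g) B {0..<n}" by (rule bij_betw_inv_into[OF g])
      have "inj_on (?h f) {0..<n}"
        using f gi by (auto simp: inj_on_def bij_betw_def PiE_iff)
      moreover have "?h f ` {0..<n} \<subseteq> {0..<n}"
        using f bij_betwE[OF gi] by (auto simp: PiE_iff)
      ultimately have "bij_betw (?h f) {0..<n} {0..<n}"
        unfolding bij_betw_def using endo_inj_surj[of "{0..<n}" "?h f"] by blast
      then show "?h f permutes {0..<n}" by (rule bij_imp_permutes) auto
    qed
  qed
  then have "card {p. p permutes {0..<n}} = card ?F" by (rule bij_betw_same_card)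
  then show ?thesis using card_permutations[of "{0..<n}" n] by simp
qed

text \<open>In the squared expansion each member of \<open>\<B>\<close> arises from its
  \<open>n!\<close> orderings, each with squared minor 1; this cancels the factorial in
  \<open>fact_det_gram\<close>.\<close>

lemma det_gram_unimodular:
  fixes a :: "nat \<Rightarrow> 'e \<Rightarrow> 'a::field_char_0"
  assumes S: "finite S"
    and bs: "\<And>B. B \<in> \<B> \<Longrightarrow> B \<subseteq> S \<and> card B = n"
    and um: "\<And>f. f \<in> {0..<n} \<rightarrow>\<^sub>E S \<Longrightarrow> inj_on f {0..<n} \<Longrightarrow>
      (tuple_det n a f)\<^sup>2 = (if f ` {0..<n} \<in> \<B> then 1 else 0)"
  shows "det (gram n a S w) = (\<Sum>B\<in>\<B>. \<Prod>e\<in>B. w e)"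
proof -
  let ?I = "{0..<n}"
  let ?F = "{f \<in> ?I \<rightarrow>\<^sub>E S. inj_on f ?I \<and> f ` ?I \<in> \<B>}"
  have fin: "finite (?I \<rightarrow>\<^sub>E S)" using S by (intro finite_PiE) auto
  have "\<B> \<subseteq> Pow S" using bs by auto
  then have finB: "finite \<B>" using S by (meson finite_Pow_iff finite_subset)
  have "fact n * det (gram n a S w) = (\<Sum>f\<in>?I \<rightarrow>\<^sub>E S. (\<Prod>i\<in>?I. w (f i)) * (tuple_det n a f)\<^sup>2)"
    by (rule fact_det_gram[OF S])
  \<comment> \<open>Tuples with a repetition have determinant 0, and injective ones with range
    outside \<open>\<B>\<close> have squared minor 0 by \<open>um\<close>.\<close>
  also have "\<dots> = (\<Sum>f\<in>?F. (\<Prod>i\<in>?I. w (f i)) * (tuple_det n a f)\<^sup>2)"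
    using fin um tuple_det_not_inj[of _ n a] by (intro sum.mono_neutral_right) fastforce+
  also have "\<dots> = (\<Sum>f\<in>?F. \<Prod>e\<in>f ` ?I. w e)"
    by (intro sum.cong) (auto simp: um prod.reindex)
  also have "\<dots> = (\<Sum>B\<in>\<B>. \<Sum>f\<in>{f \<in> ?F. f ` ?I = B}. \<Prod>e\<in>f ` ?I. w e)"
    using fin finB by (intro sum.group[symmetric]) auto
  also have "\<dots> = (\<Sum>B\<in>\<B>. fact n * (\<Prod>e\<in>B. w e))"
  proof (rule sum.cong[OF refl])
    fix B assume B: "B \<in> \<B>"
    then have fB: "finite B" "card B = n" "B \<subseteq> S" using bs S finite_subset by blast+
    have "{f \<in> ?F. f ` ?I = B} = {f \<in> ?I \<rightarrow>\<^sub>E B. inj_on f ?I}"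
    proof (intro Set.set_eqI iffI)
      fix f assume "f \<in> {f \<in> ?I \<rightarrow>\<^sub>E B. inj_on f ?I}"
      then have f: "f \<in> ?I \<rightarrow>\<^sub>E B" "inj_on f ?I" by auto
      have "f ` ?I = B" using f fB by (intro card_subset_eq) (auto simp: card_image)
      then show "f \<in> {f \<in> ?F. f ` ?I = B}" using f fB B by (auto simp: PiE_iff)
    qed (auto simp: PiE_iff)
    then have "card {f \<in> ?F. f ` ?I = B} = fact n" using card_inj_PiE[OF fB(2,1)] by simp
    moreover have "(\<Sum>f\<in>{f \<in> ?F. f ` ?I = B}. \<Prod>e\<in>f ` ?I. w e)
        = (\<Sum>f\<in>{f \<in> ?F. f ` ?I = B}. \<Prod>e\<in>B. w e)"
      by (intro sum.cong) auto
    ultimately show "(\<Sum>f\<in>{f \<in> ?F. f ` ?I = B}. \<Prod>e\<in>f ` ?I. w e) = fact n * (\<Prod>e\<in>B. w e)"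
      by simp
  qed
  finally show ?thesis by (simp add: sum_distrib_left[symmetric])
qed

section \<open>Kernel vectors and the sign of the roots\<close>

lemma tuple_det_eq_0_cols:
  fixes a :: "nat \<Rightarrow> 'e \<Rightarrow> 'a::field"
  shows "tuple_det n a f = 0 \<longleftrightarrow>
    (\<exists>v. (\<exists>j<n. v j \<noteq> 0) \<and> (\<forall>i<n. (\<Sum>j = 0..<n. v j * a i (f j)) = 0))"
proof -
  let ?M = "mat n n (\<lambda>(i, j). a i (f j))"
  have M: "?M \<in> carrier_mat n n" by simp
  have "tuple_det n a f = 0 \<longleftrightarrow>
      (\<exists>v. v \<in> carrier_vec n \<and> v \<noteq> 0\<^sub>v n \<and> ?M *\<^sub>v v = 0\<^sub>v n)"
    unfolding tuple_det_def by (rule det_0_iff_vec_prod_zero_field[OF M])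
  also have "\<dots> \<longleftrightarrow> (\<exists>v. (\<exists>j<n. v j \<noteq> 0) \<and> (\<forall>i<n. (\<Sum>j = 0..<n. v j * a i (f j)) = 0))"
  proof
    assume "\<exists>v. v \<in> carrier_vec n \<and> v \<noteq> 0\<^sub>v n \<and> ?M *\<^sub>v v = 0\<^sub>v n"
    then obtain v where v: "v \<in> carrier_vec n" "v \<noteq> 0\<^sub>v n" "?M *\<^sub>v v = 0\<^sub>v n" by blast
    have "\<exists>j<n. v $ j \<noteq> 0" using v(1,2) by (auto simp: vec_eq_iff)
    moreover have "(\<Sum>j = 0..<n. v $ j * a i (f j)) = 0" if "i < n" for i
      using arg_cong[OF v(3), of "\<lambda>u. u $ i"] that v(1) by (simp add: scalar_prod_def mult.commute)
    ultimately show "\<exists>v. (\<exists>j<n. v j \<noteq> 0) \<and> (\<forall>i<n. (\<Sum>j = 0..<n. v j * a i (f j)) = 0)"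
      by (intro exI[of _ "\<lambda>j. v $ j"]) blast
  next
    assume "\<exists>v. (\<exists>j<n. v j \<noteq> 0) \<and> (\<forall>i<n. (\<Sum>j = 0..<n. v j * a i (f j)) = 0)"
    then obtain v where v: "\<exists>j<n. v j \<noteq> 0" "\<forall>i<n. (\<Sum>j = 0..<n. v j * a i (f j)) = 0" by blast
    have "?M *\<^sub>v vec n v = 0\<^sub>v n"
      using v(2) by (intro eq_vecI) (auto simp: scalar_prod_def mult.commute)
    moreover have "vec n v \<noteq> 0\<^sub>v n" using v(1) by (auto simp: vec_eq_iff)
    ultimately show "\<exists>v. v \<in> carrier_vec n \<and> v \<noteq> 0\<^sub>v n \<and> ?M *\<^sub>v v = 0\<^sub>v n"
      by (intro exI[of _ "vec n v"]) auto
  qed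
  finally show ?thesis .
qed

text \<open>Makes the facts about columns applicable to rows: relations between rows, and repeated
  rows.\<close>

lemma tuple_det_swap: "tuple_det n a f = tuple_det n (\<lambda>i j. a j (f i)) id"
  using tuple_det_transpose[of n "\<lambda>i j. a i (f j)"] by (simp add: tuple_det_def)

text \<open>A kernel vector gives \<open>\<alpha> + z * \<beta> = 0\<close> with nonnegative sums of
  squared moduli. The tuple \<open>f\<close> with nonzero minor guarantees
  \<open>\<beta> \<noteq> 0\<close>.\<close>

lemma gram_root_nonpos:
  fixes a :: "nat \<Rightarrow> 'e \<Rightarrow> real"
  assumes S: "finite S"
    and f: "f ` {0..<n} \<subseteq> S" "tuple_det n a f \<noteq> 0"
    and root: "det (gram n (\<lambda>i e. complex_of_real (a i e)) S (\<lambda>e. if e \<in> R then z else 1)) = 0"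
  shows "\<exists>t\<ge>0. z = - complex_of_real t"
proof -
  let ?w = "\<lambda>e. if e \<in> R then z else 1"
  have "tuple_det n (\<lambda>i k. \<Sum>e\<in>S. ?w e * complex_of_real (a i e) * complex_of_real (a k e)) id = 0"
    using root by (simp add: gram_def tuple_det_def)
  then obtain v where v: "\<exists>j<n. v j \<noteq> 0"
    "\<forall>i<n. (\<Sum>j = 0..<n. v j * (\<Sum>e\<in>S. ?w e * complex_of_real (a i e) * complex_of_real (a j e))) = 0"
    unfolding tuple_det_eq_0_cols by auto
  \<comment> \<open>The pairing of \<open>v\<close> with column \<open>e\<close>. As the entries of
    \<open>a\<close> are real, its conjugate is the pairing with the conjugate of \<open>v\<close>,
    and the Hermitian form becomes a weighted sum of \<open>|y e|^2\<close>.\<close>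
  define y where "y e = (\<Sum>j = 0..<n. v j * complex_of_real (a j e))" for e
  have "0 = (\<Sum>i = 0..<n. cnj (v i) *
      (\<Sum>j = 0..<n. v j * (\<Sum>e\<in>S. ?w e * complex_of_real (a i e) * complex_of_real (a j e))))"
    using v(2) by simp
  also have "\<dots> = (\<Sum>i = 0..<n. \<Sum>j = 0..<n. \<Sum>e\<in>S.
      ?w e * ((v j * complex_of_real (a j e)) * (cnj (v i) * complex_of_real (a i e))))"
    by (simp add: sum_distrib_left mult_ac)
  also have "\<dots> = (\<Sum>i = 0..<n. \<Sum>e\<in>S. \<Sum>j = 0..<n.
      ?w e * ((v j * complex_of_real (a j e)) * (cnj (v i) * complex_of_real (a i e))))"
    by (intro sum.cong refl sum.swap)
  also have "\<dots> = (\<Sum>e\<in>S. \<Sum>i = 0..<n. \<Sum>j = 0..<n.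
      ?w e * ((v j * complex_of_real (a j e)) * (cnj (v i) * complex_of_real (a i e))))"
    by (rule sum.swap)
  also have "\<dots> = (\<Sum>e\<in>S. ?w e * (y e * cnj (y e)))"
    by (simp add: y_def sum_distrib_left sum_distrib_right)
  also have "\<dots> = (\<Sum>e\<in>S. if e \<in> R then z * complex_of_real ((cmod (y e))\<^sup>2) else complex_of_real ((cmod (y e))\<^sup>2))"
    by (intro sum.cong) (auto simp only: complex_norm_square mult_1 split: if_split)
  also have "\<dots> = z * complex_of_real (\<Sum>e\<in>S \<inter> R. (cmod (y e))\<^sup>2) + complex_of_real (\<Sum>e\<in>S - R. (cmod (y e))\<^sup>2)"
    using S by (subst sum.If_cases) (auto simp: sum_distrib_left Diff_eq)
  finally have eq: "z * complex_of_real (\<Sum>e\<in>S \<inter> R. (cmod (y e))\<^sup>2) + complex_of_real (\<Sum>e\<in>S - R. (cmod (y e))\<^sup>2) = 0"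
    by simp
  define \<alpha> where "\<alpha> = (\<Sum>e\<in>S - R. (cmod (y e))\<^sup>2)"
  define \<beta> where "\<beta> = (\<Sum>e\<in>S \<inter> R. (cmod (y e))\<^sup>2)"
  have nn: "\<alpha> \<ge> 0" "\<beta> \<ge> 0" by (auto simp: \<alpha>_def \<beta>_def intro: sum_nonneg)
  \<comment> \<open>If \<open>\<beta> = 0\<close> then also \<open>\<alpha> = 0\<close>, so every
    \<open>y e\<close> vanishes and \<open>v\<close> is a relation between the rows of the nonzero
    minor at \<open>f\<close>.\<close>
  have "\<beta> \<noteq> 0"
  proof
    assume b0: "\<beta> = 0"
    then have a0: "\<alpha> = 0" using eq by (simp add: \<alpha>_def[symmetric] \<beta>_def[symmetric])
    have y0: "y e = 0" if "e \<in> S" for e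
      using a0 b0 that S by (cases "e \<in> R") (auto simp: \<alpha>_def \<beta>_def sum_nonneg_eq_0_iff)
    have "(\<Sum>j = 0..<n. v j * complex_of_real (a j (f i))) = 0" if "i < n" for i
      using y0[of "f i"] f(1) that by (simp add: y_def image_subset_iff)
    then have "tuple_det n (\<lambda>i j. complex_of_real (a j (f i))) id = 0"
      unfolding tuple_det_eq_0_cols using v(1) by (intro exI[of _ v]) auto
    then show False
      using f(2) tuple_det_swap[of n "\<lambda>i e. complex_of_real (a i e)" f] by (simp add: tuple_det_of_real)
  qed
  then have "z = - complex_of_real (\<alpha> / \<beta>)"
    using eq by (simp add: \<alpha>_def[symmetric] \<beta>_def[symmetric] eq_neg_iff_add_eq_0 field_simps)
  then show ?thesis using nn by (intro exI[of _ "\<alpha> / \<beta>"]) auto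
qed

section \<open>Minors of totally unimodular matrices, and nonzero minors\<close>

lemma tuple_det_cong:
  "(\<And>i j. i < n \<Longrightarrow> j < n \<Longrightarrow> a i (f j) = b i (g j)) \<Longrightarrow> tuple_det n a f = tuple_det n b g"
  unfolding tuple_det_def by (intro arg_cong[where f = det] eq_matI) auto

text \<open>\<open>submatrix\<close> lists indices increasingly through \<open>pick\<close>. The
  permutation sends \<open>i\<close> to the rank of \<open>g i\<close> in the range, that is, the
  number of smaller elements.\<close>

lemma pick_enumerate:
  assumes g: "inj_on g {0..<n}"
  obtains p where "p permutes {0..<n}" "\<And>i. i < n \<Longrightarrow> g i = pick (g ` {0..<n}) (p i)"
proof -
  define I where "I = g ` {0..<n}"
  have cI: "card I = n" "finite I" using g by (auto simp: I_def card_image)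
  define p where "p i = (if i < n then card {a \<in> I. a < g i} else i)" for i
  have gp: "g i = pick I (p i)" if "i < n" for i
    using that pick_card_in_set[of "g i" I] by (simp add: p_def I_def)
  have "p i < n" if "i < n" for i
  proof -
    have "{a \<in> I. a < g i} \<subset> I" using that by (auto simp: I_def)
    then show ?thesis using psubset_card_mono[OF cI(2)] cI(1) that by (auto simp: p_def)
  qed
  then have "p ` {0..<n} \<subseteq> {0..<n}" by auto
  moreover have inj: "inj_on p {0..<n}"
  proof (rule inj_onI)
    fix i j assume "i \<in> {0..<n}" "j \<in> {0..<n}" "p i = p j"
    then show "i = j" using gp[of i] gp[of j] inj_onD[OF g, of i j] by simp
  qed
  ultimately have "bij_betw p {0..<n} {0..<n}"
    unfolding bij_betw_def using endo_inj_surj[of "{0..<n}" p] by blast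
  then have "p permutes {0..<n}" by (rule bij_imp_permutes) (simp add: p_def)
  then show ?thesis using that gp by (simp add: I_def)
qed

text \<open>An injective choice of rows and columns in any order differs from a submatrix by two
  permutations, hence by signs only.\<close>

lemma totally_unimodular_tuple_det:
  assumes tu: "totally_unimodular A"
    and r: "inj_on r {0..<n}" "r ` {0..<n} \<subseteq> {..<dim_row A}"
    and f: "inj_on f {0..<n}" "f ` {0..<n} \<subseteq> {..<dim_col A}"
  shows "tuple_det n (\<lambda>i j. A $$ (r i, j)) f \<in> {-1, 0, 1}"
proof -
  define I where "I = r ` {0..<n}"
  define J where "J = f ` {0..<n}"
  obtain p where p: "p permutes {0..<n}" "\<And>i. i < n \<Longrightarrow> r i = pick I (p i)"
    using pick_enumerate[OF r(1)] unfolding I_def by blast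
  obtain q where q: "q permutes {0..<n}" "\<And>i. i < n \<Longrightarrow> f i = pick J (q i)"
    using pick_enumerate[OF f(1)] unfolding J_def by blast
  have c: "card I = n" "card J = n" using r f by (auto simp: I_def J_def card_image)
  have "{i. i < dim_row A \<and> i \<in> I} = I" "{j. j < dim_col A \<and> j \<in> J} = J"
    using r f by (auto simp: I_def J_def)
  then have sub: "submatrix A I J = mat n n (\<lambda>(i, j). A $$ (pick I i, pick J j))"
    by (simp add: submatrix_def c)
  have "tuple_det n (\<lambda>i j. A $$ (r i, j)) f = tuple_det n (\<lambda>i. (\<lambda>i j. A $$ (pick I i, j)) (p i)) (pick J \<circ> q)"
    using p(2) q(2) by (intro tuple_det_cong) simp
  also have "\<dots> = signof p * tuple_det n (\<lambda>i j. A $$ (pick I i, j)) (pick J \<circ> q)"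
    by (rule tuple_det_permute_rows[OF p(1), where a = "\<lambda>i j. A $$ (pick I i, j)"])
  also have "\<dots> = signof p * (signof q * det (submatrix A I J))"
    unfolding tuple_det_permute_cols[OF q(1)] by (simp add: tuple_det_def sub)
  finally have eq: "tuple_det n (\<lambda>i j. A $$ (r i, j)) f = signof p * (signof q * det (submatrix A I J))" .
  have "I \<subseteq> {..<dim_row A} \<and> J \<subseteq> {..<dim_col A} \<and> card I = card J"
    using r f c by (auto simp: I_def J_def)
  then have "det (submatrix A I J) \<in> {-1, 0, 1}"
    using tu unfolding totally_unimodular_def by blast
  then show ?thesis unfolding eq by (auto simp: sign_def)
qed

text \<open>
  Given rows for the first \<open>n\<close> columns, expanding along an additional row \<open>i\<close> gives a combination of
  the values \<open>h i j\<close> with a nonzero coefficient at \<open>j = n\<close>; by independence it does not vanish for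
  every \<open>i\<close>.
\<close>
lemma ex_rows_tuple_det_nonzero:
  fixes h :: "'i \<Rightarrow> nat \<Rightarrow> 'a::field"
  assumes "\<And>x. (\<And>i. i \<in> X \<Longrightarrow> (\<Sum>j = 0..<n. x j * h i j) = 0) \<Longrightarrow> \<forall>j<n. x j = 0"
  shows "\<exists>r. (\<forall>i<n. r i \<in> X) \<and> tuple_det n (\<lambda>i j. h (r i) j) id \<noteq> 0"
  using assms
proof (induction n)
  case 0
  show ?case by (simp add: tuple_det_def)
next
  case (Suc n)
  have "\<forall>j<n. x j = 0" if x: "\<And>i. i \<in> X \<Longrightarrow> (\<Sum>j = 0..<n. x j * h i j) = 0" for x
  proof -
    \<comment> \<open>Padding with 0 at index \<open>n\<close> passes independence on to the first
      \<open>n\<close> columns.\<close>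
    let ?y = "\<lambda>j. if j < n then x j else 0"
    have *: "\<forall>j<Suc n. ?y j = 0"
    proof (rule Suc.prems)
      fix i assume "i \<in> X"
      have "(\<Sum>j = 0..<Suc n. ?y j * h i j) = (\<Sum>j = 0..<n. ?y j * h i j)" by simp
      also have "\<dots> = (\<Sum>j = 0..<n. x j * h i j)" by (rule sum.cong) auto
      finally show "(\<Sum>j = 0..<Suc n. ?y j * h i j) = 0" using x[OF \<open>i \<in> X\<close>] by simp
    qed
    show ?thesis
    proof (intro allI impI)
      fix j assume "j < n"
      then show "x j = 0" using *[rule_format, of j] by simp
    qed
  qed
  then obtain r where r: "\<forall>i<n. r i \<in> X" "tuple_det n (\<lambda>i j. h (r i) j) id \<noteq> 0"
    using Suc.IH by blast
  define M where "M i = mat (Suc n) (Suc n) (\<lambda>(k, j). h ((r(n := i)) k) j)" for i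
  \<comment> \<open>The cofactors along the last row; only that row of \<open>M i\<close> involves
    \<open>i\<close>, so they do not depend on it.\<close>
  define C where "C j = (-1) ^ (n + j) * det (mat n n (\<lambda>(k, l). h (r k) (if l < j then l else Suc l)))" for j
  have del: "cofactor (M i) n j = C j" if "j < Suc n" for i j
  proof -
    have "mat_delete (M i) n j = mat n n (\<lambda>(k, l). h (r k) (if l < j then l else Suc l))"
      using that unfolding mat_delete_def M_def by (intro eq_matI) auto
    then show ?thesis by (simp add: cofactor_def C_def)
  qed
  have exp: "tuple_det (Suc n) (\<lambda>k j. h ((r(n := i)) k) j) id = (\<Sum>j = 0..<Suc n. C j * h i j)" for i
  proof -
    have "tuple_det (Suc n) (\<lambda>k j. h ((r(n := i)) k) j) id = det (M i)"
      by (simp add: tuple_det_def M_def)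
    also have "\<dots> = (\<Sum>j<Suc n. M i $$ (n, j) * cofactor (M i) n j)"
      by (rule laplace_expansion_row) (simp_all add: M_def)
    also have "\<dots> = (\<Sum>j<Suc n. C j * h i j)"
    proof (rule sum.cong[OF refl])
      fix j assume "j \<in> {..<Suc n}"
      then have j: "j < Suc n" by simp
      show "M i $$ (n, j) * cofactor (M i) n j = C j * h i j"
        unfolding del[OF j] using j by (simp add: M_def)
    qed
    finally show ?thesis by (simp only: atLeast0LessThan)
  qed
  \<comment> \<open>\<open>C n\<close> is the nonzero minor of the induction hypothesis with sign 1,
    so \<open>C\<close> cannot be a relation in all rows of \<open>X\<close>.\<close>
  have "mat n n (\<lambda>(k, l). h (r k) (if l < n then l else Suc l)) = mat n n (\<lambda>(k, l). h (r k) (id l))"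
    by (intro eq_matI) auto
  then have "C n \<noteq> 0" using r(2) by (simp add: C_def tuple_det_def)
  then have "\<not> (\<forall>j<Suc n. C j = 0)" by blast
  then obtain i where i: "i \<in> X" "(\<Sum>j = 0..<Suc n. C j * h i j) \<noteq> 0"
    using Suc.prems[of C] by blast
  have "\<forall>k<Suc n. (r(n := i)) k \<in> X" using i r(1) by (simp add: less_Suc_eq)
  moreover have "tuple_det (Suc n) (\<lambda>k j. h ((r(n := i)) k) j) id \<noteq> 0"
    unfolding exp by (rule i(2))
  ultimately show ?case by blast
qed

section \<open>Regular matroids\<close>

text \<open>Replaces linear independence of a set of vectors plus injectivity by coefficient
  families indexed by elements, the form in which relations are combined below.\<close>

lemma represented_by_indep_iff:
  assumes rep: "represented_by E indep A \<phi>" and S: "S \<subseteq> E"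
  shows "indep S \<longleftrightarrow>
    (\<forall>x. (\<forall>i<dim_row A. (\<Sum>e\<in>S. x e * A $$ (i, \<phi> e)) = 0) \<longrightarrow> (\<forall>e\<in>S. x e = 0))"
    (is "_ \<longleftrightarrow> ?free")
proof -
  define m where "m = dim_row A"
  interpret vec_space "TYPE(real)" m .
  define v where "v e = col A (\<phi> e)" for e
  have bij: "bij_betw \<phi> E {..<dim_col A}" using rep by (simp add: represented_by_def)
  then have "finite E" using bij_betw_finite by blast
  then have fS: "finite S" using S finite_subset by blast
  have vc: "v e \<in> carrier_vec m" for e by (simp add: v_def m_def carrier_vecI)
  have vi: "v e $ i = A $$ (i, \<phi> e)" if "e \<in> S" "i < m" for e i
  proof -
    have "\<phi> e < dim_col A" using that S bij by (auto simp: bij_betw_def)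
    then show ?thesis using that by (simp add: v_def m_def)
  qed
  have ind: "indep S \<longleftrightarrow> inj_on v S \<and> lin_indpt (v ` S)"
    using rep S unfolding represented_by_def v_def m_def by blast
  show ?thesis
  proof
    assume "indep S"
    then have inj: "inj_on v S" and li: "lin_indpt (v ` S)" using ind by auto
    show ?free
    proof (intro allI impI ballI, rule ccontr)
      fix x e0 assume x: "\<forall>i<dim_row A. (\<Sum>e\<in>S. x e * A $$ (i, \<phi> e)) = 0" and e0: "e0 \<in> S" "x e0 \<noteq> 0"
      define a where "a u = x (inv_into S v u)" for u
      have av: "a (v e) = x e" if "e \<in> S" for e using that inj by (simp add: a_def)
      have sub: "v ` S \<subseteq> carrier_vec m" using vc by blast
      have "lincomb a (v ` S) = 0\<^sub>v m"
      proof (rule eq_vecI)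
        fix i assume i: "i < dim_vec (0\<^sub>v m :: real vec)"
        then have "lincomb a (v ` S) $ i = (\<Sum>u\<in>v ` S. a u * u $ i)"
          using lincomb_index[OF _ sub] by simp
        also have "\<dots> = (\<Sum>e\<in>S. x e * A $$ (i, \<phi> e))"
          using i by (simp add: sum.reindex[OF inj] av vi)
        finally show "lincomb a (v ` S) $ i = 0\<^sub>v m $ i" using x i by (simp add: m_def)
      qed (use lincomb_dim[OF _ sub] fS in simp)
      moreover have "a (v e0) \<noteq> 0" using av e0 by simp
      ultimately have "lin_dep (v ` S)"
        unfolding lin_dep_def using fS e0(1)
        by (intro exI[of _ "v ` S"] exI[of _ a] exI[of _ "v e0"]) auto
      then show False using li by simp
    qed
  next
    assume free: ?free
    have "inj_on v S"
    proof (rule inj_onI, rule ccontr)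
      fix e1 e2 assume e: "e1 \<in> S" "e2 \<in> S" "v e1 = v e2" "e1 \<noteq> e2"
      \<comment> \<open>Two equal columns satisfy the relation with coefficients 1 and -1.\<close>
      let ?x = "\<lambda>e. if e = e1 then 1 else if e = e2 then - 1 else (0::real)"
      have "(\<Sum>e\<in>S. ?x e * A $$ (i, \<phi> e)) = 0" if "i < dim_row A" for i
      proof -
        have "(\<Sum>e\<in>S. ?x e * A $$ (i, \<phi> e)) = (\<Sum>e\<in>{e1, e2}. ?x e * A $$ (i, \<phi> e))"
          using fS e by (intro sum.mono_neutral_right) auto
        also have "\<dots> = v e1 $ i - v e2 $ i"
          using e that vi[of e1 i] vi[of e2 i] by (simp add: m_def)
        finally show ?thesis using e by simp
      qed
      then show False using free[rule_format, of ?x e1] e by auto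
    qed
    moreover have "lin_indpt (v ` S)"
    proof
      assume "lin_dep (v ` S)"
      then obtain T a u where T: "finite T" "T \<subseteq> v ` S" "lincomb a T = 0\<^sub>v m" "u \<in> T" "a u \<noteq> 0"
        unfolding lin_dep_def by auto
      \<comment> \<open>A dependence may involve only a subset \<open>T\<close> of the columns; the
        other coefficients are 0.\<close>
      let ?x = "\<lambda>e. if v e \<in> T then a (v e) else 0"
      have "(\<Sum>e\<in>S. ?x e * A $$ (i, \<phi> e)) = 0" if i: "i < dim_row A" for i
      proof -
        have "(\<Sum>e\<in>S. ?x e * A $$ (i, \<phi> e)) = (\<Sum>e\<in>S. (\<lambda>u. (if u \<in> T then a u else 0) * u $ i) (v e))"
          using i by (intro sum.cong) (auto simp: vi m_def)
        also have "\<dots> = (\<Sum>u\<in>v ` S. (if u \<in> T then a u else 0) * u $ i)"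
          by (simp only: sum.reindex[OF \<open>inj_on v S\<close>] comp_def)
        also have "\<dots> = (\<Sum>u\<in>T. a u * u $ i)"
          using T fS by (intro sum.mono_neutral_cong_right) auto
        also have "\<dots> = lincomb a T $ i"
          using lincomb_index[of i T a] i T(2) vc unfolding m_def[symmetric] by force
        finally show ?thesis using T(3) i by (simp add: m_def)
      qed
      moreover obtain e where "e \<in> S" "u = v e" using T by blast
      ultimately show False using free[rule_format, of ?x e] T by auto
    qed
    ultimately show "indep S" using ind by blast
  qed
qed

lemma represented_by_indepD:
  assumes "represented_by E indep A \<phi>" "S \<subseteq> E" "indep S"
    and "\<And>i. i < dim_row A \<Longrightarrow> (\<Sum>e\<in>S. x e * A $$ (i, \<phi> e)) = 0" "e \<in> S"
  shows "x e = 0"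
  using represented_by_indep_iff[OF assms(1,2)] assms(3-5) by simp

section \<open>Bases as independent sets of maximal cardinality\<close>

context matroid
begin

lemma finite_indep_sets: "finite {I. indep I}"
  using finite_ground indep_subset_ground by (auto intro: finite_subset[of _ "Pow E"])

lemma indep_card_le_rank: "indep I \<Longrightarrow> card I \<le> matroid_rank indep"
  unfolding matroid_rank_def using finite_indep_sets by (intro Max_ge) auto

lemma ex_indep_card_rank: "\<exists>B. indep B \<and> card B = matroid_rank indep"
proof -
  have "Max (card ` {I. indep I}) \<in> card ` {I. indep I}"
    using finite_indep_sets indep_empty by (intro Max_in) auto
  then show ?thesis by (auto simp: matroid_rank_def)
qed

text \<open>A basis smaller than the rank could be augmented from an independent set of rank
  size.\<close>

lemma matroid_basis_iff: "matroid_basis indep B \<longleftrightarrow> indep B \<and> card B = matroid_rank indep"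
proof
  assume B: "matroid_basis indep B"
  then have iB: "indep B" by (simp add: matroid_basis_def)
  obtain C where C: "indep C" "card C = matroid_rank indep" using ex_indep_card_rank by blast
  have "\<not> card B < card C"
  proof
    assume "card B < card C"
    then obtain e where "e \<in> C - B" "indep (insert e B)" using indep_augment[OF iB C(1)] by blast
    then show False using B unfolding matroid_basis_def by blast
  qed
  then show "indep B \<and> card B = matroid_rank indep"
    using iB indep_card_le_rank[OF iB] C(2) by simp
next
  assume B: "indep B \<and> card B = matroid_rank indep"
  have "I = B" if "indep I" "B \<subseteq> I" for I
  proof -
    have "finite I" using indep_subset_ground[OF that(1)] finite_ground finite_subset by blast
    then show ?thesis using card_seteq[of I B] that indep_card_le_rank[OF that(1)] B by simp
  qed
  then show "matroid_basis indep B" using B by (simp add: matroid_basis_def)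
qed

end

text \<open>
  For the implication from right to left: every column is a combination of those of the basis \<open>B\<close>, so
  a relation that holds in the rows \<open>r i\<close> holds in all rows, as the minor of \<open>B\<close> in these rows is
  nonzero.
\<close>
lemma tuple_det_nonzero_iff_indep:
  assumes m: "matroid E indep" and rep: "represented_by E indep A \<phi>"
    and rank: "matroid_rank indep = n"
    and r: "\<And>i. i < n \<Longrightarrow> r i < dim_row A"
    and g: "bij_betw g {0..<n} B" "indep B" "tuple_det n (\<lambda>i e. A $$ (r i, \<phi> e)) g \<noteq> 0"
    and f: "f ` {0..<n} \<subseteq> E" "inj_on f {0..<n}"
  shows "tuple_det n (\<lambda>i e. A $$ (r i, \<phi> e)) f \<noteq> 0 \<longleftrightarrow> indep (f ` {0..<n})"
proof -
  interpret matroid E indep by (rule m)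
  have BE: "B \<subseteq> E" using indep_subset_ground g(2) .
  have fB: "finite B" using BE finite_ground finite_subset by blast
  have cB: "card B = n" using bij_betw_same_card[OF g(1)] by simp
  have span: "\<exists>u. \<forall>i<dim_row A. A $$ (i, \<phi> e) = (\<Sum>j = 0..<n. u j * A $$ (i, \<phi> (g j)))" if e: "e \<in> E" for e
  proof -
    have "\<exists>y. \<forall>i<dim_row A. A $$ (i, \<phi> e) = (\<Sum>b\<in>B. y b * A $$ (i, \<phi> b))"
    proof (cases "e \<in> B")
      case True
      then show ?thesis using fB
        by (intro exI[of _ "\<lambda>b. if b = e then 1 else 0"]) (simp add: if_distrib[of "\<lambda>c. c * _"] cong: if_cong)
    next
      case False
      \<comment> \<open>\<open>insert e B\<close> exceeds the rank and so carries a relation; its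
        coefficient at \<open>e\<close> is nonzero because \<open>B\<close> is independent, and
        dividing by it expresses column \<open>e\<close>.\<close>
      have "\<not> indep (insert e B)"
        using indep_card_le_rank[of "insert e B"] False fB cB rank by auto
      moreover have "insert e B \<subseteq> E" using BE e by blast
      ultimately have "\<not> (\<forall>x. (\<forall>i<dim_row A. (\<Sum>b\<in>insert e B. x b * A $$ (i, \<phi> b)) = 0)
          \<longrightarrow> (\<forall>b\<in>insert e B. x b = 0))"
        using represented_by_indep_iff[OF rep, of "insert e B"] by blast
      then obtain x e' where x: "\<And>i. i < dim_row A \<Longrightarrow> (\<Sum>b\<in>insert e B. x b * A $$ (i, \<phi> b)) = 0"
        and e': "e' \<in> insert e B" "x e' \<noteq> 0"
        by blast
      have x': "x e * A $$ (i, \<phi> e) = - (\<Sum>b\<in>B. x b * A $$ (i, \<phi> b))" if "i < dim_row A" for i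
        using x[OF that] False fB by (simp add: add_eq_0_iff2)
      have "x e \<noteq> 0"
      proof
        assume "x e = 0"
        then have "\<forall>i<dim_row A. (\<Sum>b\<in>B. x b * A $$ (i, \<phi> b)) = 0" using x' by simp
        then have "\<forall>b\<in>B. x b = 0"
          using represented_by_indepD[OF rep BE g(2)] by blast
        then show False using e' \<open>x e = 0\<close> by auto
      qed
      have "A $$ (i, \<phi> e) = (\<Sum>b\<in>B. - x b / x e * A $$ (i, \<phi> b))" if "i < dim_row A" for i
      proof -
        have "A $$ (i, \<phi> e) = (x e * A $$ (i, \<phi> e)) / x e" using \<open>x e \<noteq> 0\<close> by simp
        also have "\<dots> = (\<Sum>b\<in>B. - x b / x e * A $$ (i, \<phi> b))"
          unfolding x'[OF that] by (simp add: sum_negf sum_divide_distrib)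
        finally show ?thesis .
      qed
      then show ?thesis by (intro exI[of _ "\<lambda>b. - x b / x e"]) blast
    qed
    then obtain y where y: "\<And>i. i < dim_row A \<Longrightarrow> A $$ (i, \<phi> e) = (\<Sum>b\<in>B. y b * A $$ (i, \<phi> b))"
      by blast
    have "A $$ (i, \<phi> e) = (\<Sum>j = 0..<n. y (g j) * A $$ (i, \<phi> (g j)))" if "i < dim_row A" for i
      unfolding y[OF that]
      by (rule sum.reindex_bij_betw[OF g(1), of "\<lambda>b. y b * A $$ (i, \<phi> b)", symmetric])
    then show ?thesis by (intro exI[of _ "\<lambda>j. y (g j)"]) blast
  qed
  let ?S = "f ` {0..<n}"
  have sumS: "(\<Sum>e\<in>?S. x e * A $$ (i, \<phi> e)) = (\<Sum>j = 0..<n. x (f j) * A $$ (i, \<phi> (f j)))" for x i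
    by (simp add: sum.reindex[OF f(2)])
  show ?thesis
  proof
    assume nz: "tuple_det n (\<lambda>i e. A $$ (r i, \<phi> e)) f \<noteq> 0"
    show "indep ?S"
      unfolding represented_by_indep_iff[OF rep f(1)] sumS
    proof (intro allI impI ballI)
      fix x e assume x: "\<forall>i<dim_row A. (\<Sum>j = 0..<n. x (f j) * A $$ (i, \<phi> (f j))) = 0" and e: "e \<in> ?S"
      have "\<not> ((\<exists>j<n. x (f j) \<noteq> 0) \<and> (\<forall>i<n. (\<Sum>j = 0..<n. x (f j) * A $$ (r i, \<phi> (f j))) = 0))"
        using nz unfolding tuple_det_eq_0_cols not_ex by (rule spec)
      then have "\<forall>j<n. x (f j) = 0" using x r by blast
      then show "x e = 0" using e by auto
    qed
  next
    assume iS: "indep ?S"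
    show "tuple_det n (\<lambda>i e. A $$ (r i, \<phi> e)) f \<noteq> 0"
    proof
      assume "tuple_det n (\<lambda>i e. A $$ (r i, \<phi> e)) f = 0"
      then obtain v where v: "\<exists>j<n. v j \<noteq> 0" "\<And>i. i < n \<Longrightarrow> (\<Sum>j = 0..<n. v j * A $$ (r i, \<phi> (f j))) = 0"
        unfolding tuple_det_eq_0_cols by blast
      have "\<forall>e\<in>E. \<exists>u. \<forall>i<dim_row A. A $$ (i, \<phi> e) = (\<Sum>j = 0..<n. u j * A $$ (i, \<phi> (g j)))"
        using span by blast
      from bchoice[OF this] obtain u where u: "\<And>e i. e \<in> E \<Longrightarrow> i < dim_row A \<Longrightarrow>
          A $$ (i, \<phi> e) = (\<Sum>j = 0..<n. u e j * A $$ (i, \<phi> (g j)))"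
        by blast
      \<comment> \<open>The relation \<open>v\<close> rewritten in the columns of the basis. It
        vanishes in the rows \<open>r i\<close>, so the nonzero minor of \<open>B\<close> forces
        \<open>d = 0\<close>, and then the relation holds in every row.\<close>
      define d where "d j = (\<Sum>k = 0..<n. v k * u (f k) j)" for j
      have d: "(\<Sum>k = 0..<n. v k * A $$ (i, \<phi> (f k))) = (\<Sum>j = 0..<n. d j * A $$ (i, \<phi> (g j)))"
        if "i < dim_row A" for i
      proof -
        have "(\<Sum>k = 0..<n. v k * A $$ (i, \<phi> (f k)))
            = (\<Sum>k = 0..<n. \<Sum>j = 0..<n. v k * u (f k) j * A $$ (i, \<phi> (g j)))"
        proof (rule sum.cong[OF refl])
          fix k assume "k \<in> {0..<n}"
          then have "f k \<in> E" using f(1) by blast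
          then show "v k * A $$ (i, \<phi> (f k)) = (\<Sum>j = 0..<n. v k * u (f k) j * A $$ (i, \<phi> (g j)))"
            unfolding u[OF \<open>f k \<in> E\<close> that] by (simp only: sum_distrib_left mult.assoc)
        qed
        also have "\<dots> = (\<Sum>j = 0..<n. \<Sum>k = 0..<n. v k * u (f k) j * A $$ (i, \<phi> (g j)))"
          by (rule sum.swap)
        also have "\<dots> = (\<Sum>j = 0..<n. d j * A $$ (i, \<phi> (g j)))"
          by (simp only: d_def sum_distrib_right)
        finally show ?thesis .
      qed
      have "(\<Sum>j = 0..<n. d j * A $$ (r i, \<phi> (g j))) = 0" if "i < n" for i
        using d[OF r[OF that]] v(2)[OF that] by simp
      then have d0: "d j = 0" if "j < n" for j
        using g(3) that unfolding tuple_det_eq_0_cols by blast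
      let ?x = "\<lambda>e. v (inv_into {0..<n} f e)"
      have xf: "?x (f j) = v j" if "j < n" for j
        using that inv_into_f_f[OF f(2)] by simp
      have "(\<Sum>j = 0..<n. ?x (f j) * A $$ (i, \<phi> (f j))) = 0" if i: "i < dim_row A" for i
      proof -
        have "(\<Sum>j = 0..<n. ?x (f j) * A $$ (i, \<phi> (f j))) = (\<Sum>k = 0..<n. v k * A $$ (i, \<phi> (f k)))"
          by (rule sum.cong[OF refl]) (simp add: xf)
        also have "\<dots> = 0" unfolding d[OF i] by (rule sum.neutral) (simp add: d0)
        finally show ?thesis .
      qed
      then have 0: "?x e = 0" if "e \<in> ?S" for e
        using represented_by_indepD[OF rep f(1) iS, of ?x e] that unfolding sumS by simp
      have "v j = 0" if "j < n" for j
      proof -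
        have "f j \<in> ?S" using that by simp
        from 0[OF this] show ?thesis using xf[OF that] by simp
      qed
      then show False using v(1) by blast
    qed
  qed
qed

text \<open>Fix a basis and \<open>n\<close> rows in which its minor is nonzero. In these rows total
  unimodularity bounds every minor to -1, 0 or 1, and it is nonzero exactly on bases, so squares are
  indicators.\<close>

lemma regular_matroid_tuples:
  assumes reg: "regular_matroid E indep" and rank: "matroid_rank indep = n"
  obtains a :: "nat \<Rightarrow> 'a \<Rightarrow> real" where
    "\<And>f. f ` {0..<n} \<subseteq> E \<Longrightarrow> inj_on f {0..<n} \<Longrightarrow>
      (tuple_det n a f)\<^sup>2 = (if matroid_basis indep (f ` {0..<n}) then 1 else 0)"
proof -
  obtain A \<phi> where tu: "totally_unimodular A" and rep: "represented_by E indep A \<phi>"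
    and m: "matroid E indep"
    using reg by (auto simp: regular_matroid_def)
  interpret matroid E indep by (rule m)
  have bij: "bij_betw \<phi> E {..<dim_col A}" using rep by (simp add: represented_by_def)
  obtain B where B: "indep B" "card B = n" using ex_indep_card_rank rank by blast
  have BE: "B \<subseteq> E" using indep_subset_ground[OF B(1)] .
  obtain g where g: "bij_betw g {0..<n} B"
    using ex_bij_betw_nat_finite[of B] B(2) BE finite_ground finite_subset by blast
  have "\<forall>j<n. x j = 0"
    if x: "\<And>i. i \<in> {..<dim_row A} \<Longrightarrow> (\<Sum>j = 0..<n. x j * A $$ (i, \<phi> (g j))) = 0" for x
  proof -
    let ?y = "\<lambda>b. x (inv_into {0..<n} g b)"
    have yg: "?y (g j) = x j" if "j < n" for j
      using that bij_betw_inv_into_left[OF g] by simp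
    have "(\<Sum>b\<in>B. ?y b * A $$ (i, \<phi> b)) = 0" if "i < dim_row A" for i
      using sum.reindex_bij_betw[OF g, of "\<lambda>b. ?y b * A $$ (i, \<phi> b)"] x[of i] that by (simp add: yg)
    then have y0: "?y b = 0" if "b \<in> B" for b
      by (rule represented_by_indepD[OF rep BE B(1) _ that])
    show ?thesis
    proof (intro allI impI)
      fix j assume "j < n"
      moreover from this have "g j \<in> B" using bij_betwE[OF g] by simp
      ultimately show "x j = 0" using yg y0 by metis
    qed
  qed
  from ex_rows_tuple_det_nonzero[where X = "{..<dim_row A}" and h = "\<lambda>i j. A $$ (i, \<phi> (g j))", OF this]
  obtain r where r: "\<forall>i<n. r i < dim_row A" "tuple_det n (\<lambda>i j. A $$ (r i, \<phi> (g j))) id \<noteq> 0"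
    by auto
  \<comment> \<open>Equal rows would make the minor vanish; injectivity is what lets the rows index
    a submatrix.\<close>
  have rinj: "inj_on r {0..<n}"
  proof (rule ccontr)
    assume "\<not> inj_on r {0..<n}"
    then have "tuple_det n (\<lambda>j k. A $$ (k, \<phi> (g j))) r = 0" by (rule tuple_det_not_inj)
    then show False using r(2) tuple_det_swap[of n "\<lambda>j k. A $$ (k, \<phi> (g j))" r] by simp
  qed
  have gnz: "tuple_det n (\<lambda>i e. A $$ (r i, \<phi> e)) g \<noteq> 0"
    using r(2) by (simp add: tuple_det_def)
  show ?thesis
  proof (rule that)
    fix f :: "nat \<Rightarrow> 'a" assume f: "f ` {0..<n} \<subseteq> E" "inj_on f {0..<n}"
    have "tuple_det n (\<lambda>i j. A $$ (r i, j)) (\<phi> \<circ> f) \<in> {-1, 0, 1}"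
    proof (rule totally_unimodular_tuple_det[OF tu rinj])
      show "r ` {0..<n} \<subseteq> {..<dim_row A}" using r(1) by auto
      show "inj_on (\<phi> \<circ> f) {0..<n}"
        using f bij by (intro comp_inj_on) (auto simp: bij_betw_def intro: inj_on_subset)
      show "(\<phi> \<circ> f) ` {0..<n} \<subseteq> {..<dim_col A}"
        using f bij by (auto simp: bij_betw_def)
    qed
    then have "tuple_det n (\<lambda>i e. A $$ (r i, \<phi> e)) f \<in> {-1, 0, 1}"
      by (simp add: tuple_det_def)
    moreover have "tuple_det n (\<lambda>i e. A $$ (r i, \<phi> e)) f \<noteq> 0 \<longleftrightarrow> indep (f ` {0..<n})"
      using r(1) by (intro tuple_det_nonzero_iff_indep[OF m rep rank _ g B(1) gnz f]) auto
    moreover have "matroid_basis indep (f ` {0..<n}) \<longleftrightarrow> indep (f ` {0..<n})"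
      using f(2) rank by (auto simp: matroid_basis_iff card_image)
    ultimately show "(tuple_det n (\<lambda>i e. A $$ (r i, \<phi> e)) f)\<^sup>2
        = (if matroid_basis indep (f ` {0..<n}) then 1 else 0)"
      by auto
  qed
qed

section \<open>The generating polynomial of the basis counts\<close>

lemma basis_count_esym:
  assumes reg: "regular_matroid E indep" and rank: "matroid_rank indep = n"
    and N0: "basis_count indep R 0 > 0" and Nn: "basis_count indep R n > 0"
  obtains xs where "length xs = n" "\<forall>x\<in>set xs. x > 0"
    "\<And>k. k \<le> n \<Longrightarrow> real (basis_count indep R k) = real (basis_count indep R 0) * esym xs k"
proof -
  interpret matroid E indep using reg by (simp add: regular_matroid_def)
  let ?\<B> = "{B. matroid_basis indep B}"
  have bs: "B \<subseteq> E \<and> card B = n" if "B \<in> ?\<B>" for B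
    using that rank indep_subset_ground by (auto simp: matroid_basis_iff)
  have finB: "finite ?\<B>"
    using finite_indep_sets by (rule rev_finite_subset) (auto simp: matroid_basis_def)
  obtain a :: "nat \<Rightarrow> 'a \<Rightarrow> real" where a: "\<And>f. f ` {0..<n} \<subseteq> E \<Longrightarrow> inj_on f {0..<n} \<Longrightarrow>
      (tuple_det n a f)\<^sup>2 = (if matroid_basis indep (f ` {0..<n}) then 1 else 0)"
    using regular_matroid_tuples[OF reg rank] by blast
  obtain B where B: "matroid_basis indep B"
    using ex_indep_card_rank matroid_basis_iff by blast
  obtain g where g: "bij_betw g {0..<n} B"
    using ex_bij_betw_nat_finite[of B] bs[of B] B finite_ground finite_subset by blast
  have gE: "g ` {0..<n} \<subseteq> E" using g bs B by (auto simp: bij_betw_def)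
  have "(tuple_det n a g)\<^sup>2 = 1"
    using a[OF gE] g B by (simp add: bij_betw_def)
  then have gnz: "tuple_det n a g \<noteq> 0" by auto
  define p where "p = (\<Sum>k\<le>n. monom (real (basis_count indep R k)) k)"
  have cp: "coeff p k = (if k \<le> n then real (basis_count indep R k) else 0)" for k
    by (simp add: p_def coeff_sum)
  \<comment> \<open>The leading coefficient is the count at \<open>n\<close>, positive by
    \<open>Nn\<close>; this gives the list its full length \<open>n\<close>.\<close>
  have "degree p = n"
    using Nn cp by (intro antisym degree_le le_degree) auto
  have pz: "poly (map_poly complex_of_real p) z
      = det (gram n (\<lambda>i e. complex_of_real (a i e)) E (\<lambda>e. if e \<in> R then z else 1))" for z
  proof -
    have "poly (map_poly complex_of_real p) z = (\<Sum>k\<le>n. of_nat (basis_count indep R k) * z ^ k)"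
      unfolding poly_altdef using \<open>degree p = n\<close> by (simp add: coeff_map_poly cp)
    also have "\<dots> = (\<Sum>k\<le>n. \<Sum>B | B \<in> ?\<B> \<and> card (B \<inter> R) = k. z ^ card (B \<inter> R))"
      by (intro sum.cong) (auto simp: basis_count_def)
    \<comment> \<open>Bases are grouped by the size of their intersection with \<open>R\<close>; the
      power of \<open>z\<close> is then a product of weights, \<open>z\<close> on \<open>R\<close>
      and 1 elsewhere, as in the Gram determinant.\<close>
    also have "\<dots> = (\<Sum>B\<in>?\<B>. z ^ card (B \<inter> R))"
    proof (rule sum.group[OF finB finite_atMost,
          where g = "\<lambda>B. card (B \<inter> R)" and h = "\<lambda>B. z ^ card (B \<inter> R)"])
      show "(\<lambda>B. card (B \<inter> R)) ` ?\<B> \<subseteq> {..n}"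
      proof (rule image_subsetI)
        fix B assume "B \<in> ?\<B>"
        then have "finite B" "card B = n" using bs[of B] finite_ground finite_subset by auto
        then show "card (B \<inter> R) \<in> {..n}" using card_mono[of B "B \<inter> R"] by auto
      qed
    qed
    also have "\<dots> = (\<Sum>B\<in>?\<B>. \<Prod>e\<in>B. if e \<in> R then z else 1)"
    proof (rule sum.cong[OF refl])
      fix B assume "B \<in> ?\<B>"
      then have "finite B" using bs[of B] finite_ground finite_subset by auto
      then show "z ^ card (B \<inter> R) = (\<Prod>e\<in>B. if e \<in> R then z else 1)"
        by (simp add: prod.If_cases Int_def)
    qed
    also have "\<dots> = det (gram n (\<lambda>i e. complex_of_real (a i e)) E (\<lambda>e. if e \<in> R then z else 1))"
    proof (rule det_gram_unimodular[OF finite_ground bs, symmetric])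
      fix f :: "nat \<Rightarrow> 'a" assume f: "f \<in> {0..<n} \<rightarrow>\<^sub>E E" "inj_on f {0..<n}"
      have "f ` {0..<n} \<subseteq> E" using f(1) by auto
      have "(tuple_det n (\<lambda>i e. complex_of_real (a i e)) f)\<^sup>2 = complex_of_real ((tuple_det n a f)\<^sup>2)"
        by (simp add: tuple_det_of_real)
      then show "(tuple_det n (\<lambda>i e. complex_of_real (a i e)) f)\<^sup>2 = (if f ` {0..<n} \<in> ?\<B> then 1 else 0)"
        using a[OF \<open>f ` {0..<n} \<subseteq> E\<close> f(2)] by simp
    qed
    finally show ?thesis .
  qed
  have "\<exists>t>0. z = - complex_of_real t" if z: "poly (map_poly complex_of_real p) z = 0" for z
  proof -
    obtain t where t: "t \<ge> 0" "z = - complex_of_real t"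
      using gram_root_nonpos[OF finite_ground gE gnz] z pz by auto
    \<comment> \<open>The constant coefficient is the count at 0, so \<open>N0\<close> turns
      nonpositive roots into negative ones.\<close>
    have "z \<noteq> 0"
    proof
      assume "z = 0"
      then have "coeff p 0 = 0" using z by (simp add: poly_0_coeff_0 coeff_map_poly)
      then show False using cp[of 0] N0 by simp
    qed
    then show ?thesis using t by (intro exI[of _ t]) auto
  qed
  from esym_of_negative_roots[OF this] obtain xs where xs: "length xs = degree p"
    "\<forall>x\<in>set xs. x > 0" "\<And>k. coeff p k = coeff p 0 * esym xs k" by blast
  have "real (basis_count indep R k) = real (basis_count indep R 0) * esym xs k" if "k \<le> n" for k
    using xs(3)[of k] that unfolding cp by simp
  then show ?thesis using that[of xs] xs(1,2) \<open>degree p = n\<close> by blast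
qed

text \<open>The normalised counts are \<open>c\<close> times the means with \<open>c = N_0\<close>,
  and both conditions are homogeneous, of degrees \<open>n\<close> and 2, so \<open>c\<close>
  cancels. For \<open>n = 1\<close> the first condition is an identity while no \<open>k\<close>
  exists, whence \<open>n \<ge> 2\<close>.\<close>

theorem lemma3p3p8:
  fixes E R :: "'a set" and indep :: "'a set \<Rightarrow> bool" and n :: nat
  assumes "regular_matroid E indep"
    and "loopless E indep"
    and "matroid_rank indep = n"
    and "n \<ge> 2"
    and "R \<subseteq> E"
    and "norm_basis_count indep R 0 > 0"
    and "norm_basis_count indep R n > 0"
  shows "norm_basis_count indep R 1 ^ n
           = norm_basis_count indep R 0 ^ (n - 1) * norm_basis_count indep R n
         \<longleftrightarrow> (\<exists>k\<in>{1..n - 1}. (norm_basis_count indep R k)\<^sup>2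
                = norm_basis_count indep R (k - 1) * norm_basis_count indep R (k + 1))"
proof -
  have pos: "basis_count indep R 0 > 0" "basis_count indep R n > 0"
    using assms(6,7) by (auto simp: norm_basis_count_def zero_less_divide_iff)
  obtain xs where xs: "length xs = n" "\<forall>x\<in>set xs. x > 0"
    "\<And>k. k \<le> n \<Longrightarrow> real (basis_count indep R k) = real (basis_count indep R 0) * esym xs k"
    using basis_count_esym[OF assms(1,3) pos] by blast
  define c where "c = real (basis_count indep R 0)"
  have c: "c > 0" using pos by (simp add: c_def)
  have N: "norm_basis_count indep R k = c * esym_mean xs k" if "k \<le> n" for k
    using xs(3)[OF that] by (simp add: norm_basis_count_def esym_mean_def c_def assms(3) xs(1))
  have "norm_basis_count indep R 1 ^ n
           = norm_basis_count indep R 0 ^ (n - 1) * norm_basis_count indep R n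
        \<longleftrightarrow> c ^ n * esym_mean xs 1 ^ n = (c ^ (n - 1) * c) * esym_mean xs n"
    using N[of 0] N[of 1] N[of n] assms(4) by (simp add: power_mult_distrib mult.assoc)
  also have "c ^ (n - 1) * c = c ^ n"
    using assms(4) by (metis One_nat_def Suc_diff_1 less_le_trans mult.commute pos2 power_Suc)
  also have "c ^ n * esym_mean xs 1 ^ n = c ^ n * esym_mean xs n \<longleftrightarrow> esym_mean xs 1 ^ n = esym_mean xs n"
    using c by simp
  also have "\<dots> \<longleftrightarrow> (\<exists>k\<in>{1..n - 1}. (esym_mean xs k)\<^sup>2 = esym_mean xs (k - 1) * esym_mean xs (k + 1))"
    by (rule esym_mean_equality_iff[OF xs(2,1) assms(4)])
  also have "\<dots> \<longleftrightarrow> (\<exists>k\<in>{1..n - 1}. (norm_basis_count indep R k)\<^sup>2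
                = norm_basis_count indep R (k - 1) * norm_basis_count indep R (k + 1))"
  proof (rule bex_cong[OF refl])
    fix k assume "k \<in> {1..n - 1}"
    then have "k \<le> n" "k - 1 \<le> n" "k + 1 \<le> n" using assms(4) by auto
    then show "(esym_mean xs k)\<^sup>2 = esym_mean xs (k - 1) * esym_mean xs (k + 1) \<longleftrightarrow>
      (norm_basis_count indep R k)\<^sup>2 = norm_basis_count indep R (k - 1) * norm_basis_count indep R (k + 1)"
      using c by (simp add: N power2_eq_square)
  qed
  finally show ?thesis .
qed

end
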